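(* Let $n\ge2$, $s_1,s_2\in(0,1)$, and let $a_1,a_2$ be continuous functions on $\partial B_1\subset\mathbb{R}^n$, bounded from above and below by two positive constants and satisfying $a_i(\omega)=a_i(-\omega)$ for all $\omega\in\partial B_1$ and $i\in\{1,2\}$. Let $\sigma\in\mathbb{R}$ and assume that either $s_1=s_2$, or $\sigma=0$. Then there exists at most one $\vartheta\in(0,\pi)$ satisfying the contact angle condition $$\int_{J_{\vartheta,\pi}}\frac{a_1(\overrightarrow{e(\vartheta)-x})}{|e(\vartheta)-x|^{n+s_1}}\,dx-\int_{J_{0,\vartheta}}\frac{a_1(\overrightarrow{e(\vartheta)-x})}{|e(\vartheta)-x|^{n+s_1}}\,dx+\sigma\int_{H^c}\frac{a_2(\overrightarrow{e(\vartheta)-x})}{|e(\vartheta)-x|^{n+s_1}}\,dx=0.\qquad(\ast)$$ Furthermore, if $$|\sigma|<\frac{\displaystyle\int_0^\pi\phi_1(\alpha)\,(\sin\alpha)^{s_1}\,d\alpha}{\displaystyle\int_0^\pi\phi_2(\alpha)\,(\sin\alpha)^{s_1}\,d\alpha},$$ then there exists a unique solution $\vartheta\in(0,\pi)$ of $(\ast)$.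
   Context: $\overrightarrow\zeta:=\zeta/|\zeta|$; $e(\alpha):=\cos\alpha\,e_1+\sin\alpha\,e_n$. $H:=\{x\in\mathbb{R}^n:x_n>0\}$ and $H^c:=\mathbb{R}^n\setminus H$. For $0\le\vartheta_1<\vartheta_2<2\pi$, $J_{\vartheta_1,\vartheta_2}:=\{x\in\mathbb{R}^n:\exists\beta\in(\vartheta_1,\vartheta_2),\rho>0\text{ with }(x_1,x_n)=\rho(\cos\beta,\sin\beta)\}$. The difference of the integrals over $J_{\vartheta,\pi}$ and $J_{0,\vartheta}$ in $(\ast)$ is understood in the principal value sense, i.e. as the limit as $\rho\searrow0$ of the difference of the integrals over $J_{\vartheta,\pi}\setminus B_\rho(e(\vartheta))$ and $J_{0,\vartheta}\setminus B_\rho(e(\vartheta))$. For $x=(x_1,x_2)$ in the unit circle of $\mathbb{R}^2$ and $j\in\{1,2\}$, $a_j^\star(x):=a_j(x)$ if $n=2$, and if $n\ge3$ $$a_j^\star(x):=\int_{\mathbb{R}^{n-2}}\frac{a_j\Big(\overrightarrow{x_1e_1+x_2e_n+|x|(0,\bar y,0)}\Big)}{\big(1+|\bar y|^2\big)^{\frac{n+s_j}{2}}}\,d\bar y,$$ where $(0,\bar y,0)\in\mathbb{R}\times\mathbb{R}^{n-2}\times\mathbb{R}$. Finally, $\phi_j(\vartheta):=a_j^\star(\cos\vartheta,\sin\vartheta)$. *)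

theory Defs
  imports "HOL-Analysis.Analysis"
begin

text \<open>
  \<open>\<real>\<^sup>n\<close> is \<^typ>\<open>real ^ 'n\<close> for a finite linearly ordered index type, so that \<open>n = CARD('n)\<close> and the
  first and last coordinates are determined by the order. The normalisation
  \<open>\<zeta> / \<bar>\<zeta>\<bar>\<close> is the library function \<^const>\<open>sgn\<close>. Functions on the unit sphere are total
  functions of which only the values on \<open>sphere 0 1\<close> matter.
\<close>

definition first_ix :: "'n::{finite,linorder}"
  where "first_ix = Min UNIV"

definition last_ix :: "'n::{finite,linorder}"
  where "last_ix = Max UNIV"

definition e_dir :: "real \<Rightarrow> real ^ 'n::{finite,linorder}"
  where "e_dir \<alpha> = cos \<alpha> *\<^sub>R axis first_ix 1 + sin \<alpha> *\<^sub>R axis last_ix 1"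

definition upper_halfspace :: "(real ^ 'n::{finite,linorder}) set"
  where "upper_halfspace = {x. x $ last_ix > 0}"

definition J_sector :: "real \<Rightarrow> real \<Rightarrow> (real ^ 'n::{finite,linorder}) set"
  where "J_sector \<theta>1 \<theta>2 =
    {x. \<exists>\<beta>\<in>{\<theta>1<..<\<theta>2}. \<exists>\<rho>>0. (x $ first_ix, x $ last_ix) = (\<rho> * cos \<beta>, \<rho> * sin \<beta>)}"

definition aniso_kernel :: "real \<Rightarrow> (real ^ 'n::finite \<Rightarrow> real) \<Rightarrow> real ^ 'n::finite \<Rightarrow> real"
  where "aniso_kernel s a z = a (sgn z) / norm z powr (real CARD('n) + s)"

text \<open>
  The contact angle condition. The principal value is required to exist, as the limit \<open>I\<close>
  of the truncated differences. Both kernels carry the exponent \<open>n + s\<^sub>1\<close>.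
\<close>

definition contact_angle_condition ::
    "real \<Rightarrow> (real ^ 'n::{finite,linorder} \<Rightarrow> real)
      \<Rightarrow> (real ^ 'n::{finite,linorder} \<Rightarrow> real) \<Rightarrow> real \<Rightarrow> real \<Rightarrow> bool"
  where "contact_angle_condition s1 a1 a2 \<sigma> \<theta> \<longleftrightarrow>
    (\<exists>I. ((\<lambda>\<rho>.
            (LINT x : J_sector \<theta> pi - ball (e_dir \<theta>) \<rho> | lborel. aniso_kernel s1 a1 (e_dir \<theta> - x))
          - (LINT x : J_sector 0 \<theta> - ball (e_dir \<theta>) \<rho> | lborel. aniso_kernel s1 a1 (e_dir \<theta> - x)))
          \<longlongrightarrow> I) (at_right 0)
      \<and> I + \<sigma> * (LINT x : - upper_halfspace | lborel. aniso_kernel s1 a2 (e_dir \<theta> - x)) = 0)"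

text \<open>
  \<open>\<real>\<^sup>n\<^sup>-\<^sup>2\<close> consists of the coordinates other than the first and the last, with the product
  Lebesgue measure; \<open>mid_embed\<close> is the isometric embedding sending \<open>y\<close> to \<open>(0, y, 0)\<close>.
\<close>

definition mid_measure :: "('n::{finite,linorder} \<Rightarrow> real) measure"
  where "mid_measure = (\<Pi>\<^sub>M i \<in> UNIV - {first_ix, last_ix}. lborel)"

definition mid_embed :: "('n::{finite,linorder} \<Rightarrow> real) \<Rightarrow> real ^ 'n::{finite,linorder}"
  where "mid_embed y = (\<chi> i. if i = first_ix \<or> i = last_ix then 0 else y i)"

definition a_star ::
    "real \<Rightarrow> (real ^ 'n::{finite,linorder} \<Rightarrow> real) \<Rightarrow> real \<times> real \<Rightarrow> real"
  where "a_star s a x =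
    (let v = fst x *\<^sub>R axis first_ix 1 + snd x *\<^sub>R axis last_ix 1 :: real ^ 'n::{finite,linorder} in
     if CARD('n) = 2 then a v
     else (LINT y | mid_measure.
             a (sgn (v + norm x *\<^sub>R mid_embed y))
               / (1 + (norm (mid_embed y :: real ^ 'n::{finite,linorder}))\<^sup>2) powr ((real CARD('n) + s) / 2)))"

definition phi :: "real \<Rightarrow> (real ^ 'n::{finite,linorder} \<Rightarrow> real) \<Rightarrow> real \<Rightarrow> real"
  where "phi s a \<theta> = a_star s a (cos \<theta>, sin \<theta>)"

end

theory Submission
  imports Defs
begin

text \<open>
Substitute \<open>z = e(\<theta>) - x\<close> and write \<open>K\<close> for the kernel, which is even in \<open>z\<close> and homogeneous
of degree \<open>-(n + s)\<close>. In the plane of the first and last coordinates, the line through \<open>0\<close> and \<open>e(\<theta>)\<close>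
separates \<open>J_sector \<theta> pi\<close> from
\<open>J_sector 0 \<theta>\<close>; \<open>side \<theta>\<close> is a linear form in these two coordinates that vanishes on it. In the variable \<open>z\<close> the two
truncated sectors are the parts of \<open>{z. z\<^sub>n < sin \<theta>, \<bar>z\<bar> \<ge> \<rho>}\<close> with \<open>side \<theta> z < 0\<close> and
\<open>side \<theta> z > 0\<close>. Since \<open>K\<close> is even, the second may be reflected in the origin, so that both lie in
the half space \<open>side \<theta> z < 0\<close>. There they have almost everything in common, including everything near
the singularity, and what remains of the difference of the integrals is
\<open>\<integral> K\<close> over \<open>{z\<^sub>n \<ge> sin \<theta>, side \<theta> z > 0}\<close> minus \<open>\<integral> K\<close> over \<open>{z\<^sub>n \<ge> sin \<theta>, side \<theta> z < 0}\<close>.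
This does not depend on \<open>\<rho>\<close> as soon as \<open>\<rho> \<le> sin \<theta>\<close>, so the principal value exists and is equal to
it (\<open>truncated_difference\<close>).

All integrals are now over cones cut off at height \<open>z\<^sub>n = sin \<theta>\<close>. In the coordinates
\<open>z = (h / sin \<alpha>) (cos \<alpha>, y, sin \<alpha>)\<close> the volume element is
\<open>h\<^sup>n\<^sup>-\<^sup>1 (sin \<alpha>)\<^sup>-\<^sup>n dh d\<alpha> dy\<close>, so homogeneity splits
the integral into a factor \<open>(sin \<theta>)\<^sup>-\<^sup>s / s\<close> coming from \<open>h\<close> and the integral of
\<open>\<phi>(\<alpha>) (sin \<alpha>)\<^sup>s\<close> over the angles of the cone, \<open>\<phi>(\<alpha>)\<close> being the integral over \<open>y\<close>
(\<open>nn_integral_homogeneous_half_space\<close>, \<open>integral_K_cone\<close>). With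
\<open>m\<^sub>j(\<theta>) = \<integral>\<^sub>0\<^sup>\<theta> \<phi>\<^sub>j(\<alpha>) (sin \<alpha>)\<^sup>s d\<alpha>\<close> the contact angle condition becomes
\<open>2 m\<^sub>1(\<theta>) = m\<^sub>1(\<pi>) + \<sigma> m\<^sub>2(\<pi>)\<close> (\<open>contact_angle_condition_iff\<close>).
As \<open>m\<^sub>1\<close> is strictly increasing from \<open>0\<close> to \<open>m\<^sub>1(\<pi>)\<close>, there is at most one solution; as it is
continuous, there is one whenever the right-hand side lies strictly between \<open>0\<close> and \<open>2 m\<^sub>1(\<pi>)\<close>, that is,
when \<open>\<bar>\<sigma>\<bar> m\<^sub>2(\<pi>) < m\<^sub>1(\<pi>)\<close>. This is the assumed bound on \<open>\<sigma>\<close> if the exponents agree, and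
it says \<open>0 < m\<^sub>1(\<pi>)\<close> if \<open>\<sigma> = 0\<close>.
\<close>

section \<open>Lebesgue measure in first, middle and last coordinates\<close>

lemma lborel_eq_distr_PiM_vec:
  "(lborel :: (real ^ 'n::finite) measure) =
     distr (\<Pi>\<^sub>M i\<in>UNIV. lborel) borel (\<lambda>f. \<chi> i. f i)"
proof (rule lborel_eqI)
  have meas: "(\<lambda>f. \<chi> i. f i) \<in> borel_measurable (\<Pi>\<^sub>M i\<in>(UNIV::'n set). (lborel :: real measure))"
    by (subst borel_measurable_euclidean_space) (auto simp: Basis_vec_def inner_axis)
  fix l u :: "real ^ 'n"
  assume le: "\<And>b. b \<in> Basis \<Longrightarrow> l \<bullet> b \<le> u \<bullet> b"
  have le': "l $ i \<le> u $ i" for i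
    using le[of "axis i 1"] by (simp add: inner_axis)
  interpret product_sigma_finite "\<lambda>_::'n. lborel :: real measure" by standard
  have "(\<lambda>f. \<chi> i. f i) -` box l u \<inter> space (\<Pi>\<^sub>M i\<in>(UNIV::'n set). (lborel :: real measure))
      = (\<Pi>\<^sub>E i\<in>UNIV. {l $ i<..<u $ i})"
    by (auto simp: space_PiM PiE_def Pi_def mem_box_cart)
  then have "emeasure (distr (\<Pi>\<^sub>M i\<in>UNIV. lborel) borel (\<lambda>f. \<chi> i. f i)) (box l u)
      = (\<Prod>i\<in>UNIV. emeasure lborel {l $ i<..<u $ i})"
    by (simp add: emeasure_distr[OF meas] emeasure_PiM)
  also have "\<dots> = ennreal (\<Prod>i\<in>UNIV. (u - l) $ i)"
    by (simp add: le' prod_ennreal)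
  also have "(\<Prod>i\<in>UNIV. (u - l) $ i) = (\<Prod>b\<in>Basis. (u - l) \<bullet> b)"
  proof -
    have B: "(Basis :: (real ^ 'n) set) = (\<lambda>i. axis i 1) ` UNIV"
      by (auto simp: Basis_vec_def)
    have "inj (\<lambda>i. axis i 1 :: real ^ 'n)"
      by (auto intro!: injI simp: axis_eq_axis)
    then show ?thesis
      by (simp add: B prod.reindex inner_axis)
  qed
  finally show "emeasure (distr (\<Pi>\<^sub>M i\<in>UNIV. lborel) borel (\<lambda>f. \<chi> i. f i)) (box l u)
      = ennreal (\<Prod>b\<in>Basis. (u - l) \<bullet> b)" .
qed simp

abbreviation mid_ix :: "'n::{finite,linorder} set"
  where "mid_ix \<equiv> UNIV - {first_ix, last_ix}"

lemma first_ix_neq_last_ix: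
  assumes "CARD('n::{finite,linorder}) \<ge> 2"
  shows "(first_ix :: 'n) \<noteq> last_ix"
proof
  assume eq: "(first_ix :: 'n) = last_ix"
  have "x = first_ix" for x :: 'n
    by (metis eq first_ix_def last_ix_def Max_ge Min_le UNIV_I finite antisym)
  then have "(UNIV :: 'n set) = {first_ix}" by auto
  then have "CARD('n) = 1" by (metis card_1_singleton_iff One_nat_def)
  with assms show False by simp
qed

lemma card_mid_ix:
  assumes "CARD('n::{finite,linorder}) \<ge> 2"
  shows "card (mid_ix :: 'n set) = CARD('n) - 2"
  using first_ix_neq_last_ix[OF assms] by (simp add: card_Diff_subset)

lemma measurable_mid_embed [measurable]:
  "(mid_embed :: ('n \<Rightarrow> real) \<Rightarrow> real ^ 'n::{finite,linorder}) \<in> mid_measure \<rightarrow>\<^sub>M borel"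
proof (subst borel_measurable_euclidean_space, intro ballI)
  fix b :: "real ^ 'n::{finite,linorder}"
  assume "b \<in> Basis"
  then obtain i where b: "b = axis i 1" by (auto simp: Basis_vec_def)
  show "(\<lambda>y. mid_embed y \<bullet> b) \<in> borel_measurable mid_measure"
    by (cases "i = first_ix \<or> i = last_ix")
       (auto simp: b mid_embed_def inner_axis mid_measure_def)
qed

lemma sigma_finite_mid_measure: "sigma_finite_measure mid_measure"
proof -
  interpret product_sigma_finite "\<lambda>_::'n. lborel :: real measure" by standard
  show ?thesis unfolding mid_measure_def by (rule sigma_finite) simp
qed

lemma nn_integral_lborel_split:
  fixes F :: "real ^ 'n::{finite,linorder} \<Rightarrow> ennreal"
  assumes n: "CARD('n) \<ge> 2" and [measurable]: "F \<in> borel_measurable borel"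
  shows "(\<integral>\<^sup>+z. F z \<partial>lborel) =
    (\<integral>\<^sup>+h. \<integral>\<^sup>+t. \<integral>\<^sup>+y. F (t *\<^sub>R axis first_ix 1 + h *\<^sub>R axis last_ix 1 + mid_embed y)
       \<partial>mid_measure \<partial>lborel \<partial>lborel)"
proof -
  interpret product_sigma_finite "\<lambda>_::'n. lborel :: real measure" by standard
  note neq = first_ix_neq_last_ix[OF n]
  define v :: "('n \<Rightarrow> real) \<Rightarrow> real ^ 'n::{finite,linorder}" where "v = (\<lambda>f. \<chi> i. f i)"
  have v: "v \<in> borel_measurable (\<Pi>\<^sub>M i\<in>(UNIV::'n set). (lborel :: real measure))"
    unfolding v_def
    by (subst borel_measurable_euclidean_space) (auto simp: Basis_vec_def inner_axis)
  have U1: "(UNIV :: 'n set) = insert last_ix (insert first_ix mid_ix)" by auto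
  have M0: "(\<lambda>f. F (v f)) \<in> borel_measurable (\<Pi>\<^sub>M i\<in>insert last_ix (insert first_ix mid_ix). (lborel :: real measure))"
    using v unfolding U1[symmetric] by measurable
  have "(\<integral>\<^sup>+z. F z \<partial>lborel) = (\<integral>\<^sup>+f. F (v f) \<partial>(\<Pi>\<^sub>M i\<in>UNIV. lborel))"
    by (subst lborel_eq_distr_PiM_vec, subst nn_integral_distr)
       (use v in \<open>simp_all add: v_def\<close>)
  also have "\<dots> = (\<integral>\<^sup>+h. \<integral>\<^sup>+f. F (v (f(last_ix := h)))
      \<partial>(\<Pi>\<^sub>M i\<in>insert first_ix mid_ix. lborel) \<partial>lborel)"
    using neq by (subst U1, intro product_nn_integral_insert_rev M0) auto
  also have "\<dots> = (\<integral>\<^sup>+h. \<integral>\<^sup>+t. \<integral>\<^sup>+y. F (v (y(first_ix := t, last_ix := h)))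
      \<partial>(\<Pi>\<^sub>M i\<in>mid_ix. lborel) \<partial>lborel \<partial>lborel)"
  proof (intro nn_integral_cong product_nn_integral_insert_rev)
    fix h :: real
    show "(\<lambda>f. F (v (f(last_ix := h)))) \<in>
        borel_measurable (\<Pi>\<^sub>M i\<in>insert first_ix mid_ix. (lborel :: real measure))"
      by (rule measurable_compose[OF _ M0]) (use neq in measurable)
  qed auto
  also have "\<dots> = (\<integral>\<^sup>+h. \<integral>\<^sup>+t. \<integral>\<^sup>+y. F (t *\<^sub>R axis first_ix 1 + h *\<^sub>R axis last_ix 1 + mid_embed y)
       \<partial>mid_measure \<partial>lborel \<partial>lborel)"
    unfolding mid_measure_def
  proof (intro nn_integral_cong arg_cong[where f = F])
    fix h t :: real and y :: "'n \<Rightarrow> real"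
    show "v (y(first_ix := t, last_ix := h)) =
        t *\<^sub>R axis first_ix 1 + h *\<^sub>R axis last_ix 1 + mid_embed y"
      using neq by (auto simp: v_def vec_eq_iff mid_embed_def axis_def)
  qed
  finally show ?thesis .
qed

text \<open>
Induction on the index set, one application of the one-dimensional scaling rule for each coordinate. The
restriction to \<open>I\<close> keeps the scaled point in the space of the product measure, whose elements are
\<open>undefined\<close> outside \<open>I\<close>.
\<close>

lemma nn_integral_PiM_lborel_scale:
  fixes c :: real and G :: "('i \<Rightarrow> real) \<Rightarrow> ennreal"
  assumes "finite I" "c > 0" and "G \<in> borel_measurable (\<Pi>\<^sub>M i\<in>I. lborel)"
  shows "(\<integral>\<^sup>+y. G y \<partial>(\<Pi>\<^sub>M i\<in>I. lborel))
    = ennreal (c ^ card I) * (\<integral>\<^sup>+y. G (\<lambda>i\<in>I. c * y i) \<partial>(\<Pi>\<^sub>M i\<in>I. lborel))"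
  using assms(1,3)
proof (induction I arbitrary: G rule: finite_induct)
  case empty
  interpret product_sigma_finite "\<lambda>_::'i. lborel :: real measure" by standard
  show ?case by (simp add: nn_integral_empty del: nn_integral_const)
next
  case (insert i I)
  interpret product_sigma_finite "\<lambda>_::'i. lborel :: real measure" by standard
  interpret I: sigma_finite_measure "\<Pi>\<^sub>M i\<in>I. (lborel :: real measure)"
    by (rule sigma_finite) fact
  note [measurable] = insert.prems
  have resc: "(\<lambda>y. \<lambda>i\<in>J. c * y i) \<in> (\<Pi>\<^sub>M i\<in>J. lborel) \<rightarrow>\<^sub>M (\<Pi>\<^sub>M i\<in>J. (lborel :: real measure))" for J :: "'i set"
    by measurable
  have Gp: "(\<lambda>p. G ((\<lambda>j\<in>I. c * snd p j)(i := fst p))) \<in> borel_measurable (lborel \<Otimes>\<^sub>M (\<Pi>\<^sub>M i\<in>I. lborel))"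
    by measurable
  have inner: "(\<lambda>x. \<integral>\<^sup>+y. G ((\<lambda>j\<in>I. c * y j)(i := x)) \<partial>(\<Pi>\<^sub>M i\<in>I. lborel)) \<in> borel_measurable lborel"
    using I.borel_measurable_nn_integral_fst[OF Gp] by simp
  have "(\<integral>\<^sup>+y. G y \<partial>(\<Pi>\<^sub>M i\<in>insert i I. lborel))
      = (\<integral>\<^sup>+x. \<integral>\<^sup>+y. G (y(i := x)) \<partial>(\<Pi>\<^sub>M i\<in>I. lborel) \<partial>lborel)"
    by (rule product_nn_integral_insert_rev) (use insert in auto)
  also have "\<dots> = (\<integral>\<^sup>+x. ennreal (c ^ card I) *
      (\<integral>\<^sup>+y. G ((\<lambda>j\<in>I. c * y j)(i := x)) \<partial>(\<Pi>\<^sub>M i\<in>I. lborel)) \<partial>lborel)"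
  proof (intro nn_integral_cong insert.IH)
    fix x :: real
    show "(\<lambda>y. G (y(i := x))) \<in> borel_measurable (\<Pi>\<^sub>M i\<in>I. lborel)"
      by measurable
  qed
  also have "\<dots> = ennreal (c ^ card I) *
      (\<integral>\<^sup>+x. \<integral>\<^sup>+y. G ((\<lambda>j\<in>I. c * y j)(i := x)) \<partial>(\<Pi>\<^sub>M i\<in>I. lborel) \<partial>lborel)"
    using inner by (rule nn_integral_cmult)
  also have "\<dots> = ennreal (c ^ card I) * (ennreal c *
      (\<integral>\<^sup>+x. \<integral>\<^sup>+y. G ((\<lambda>j\<in>I. c * y j)(i := c * x)) \<partial>(\<Pi>\<^sub>M i\<in>I. lborel) \<partial>lborel))"
    using inner \<open>c > 0\<close> by (subst nn_integral_real_affine[where c = c and t = 0]) auto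
  also have "\<dots> = ennreal (c ^ card (insert i I)) *
      (\<integral>\<^sup>+x. \<integral>\<^sup>+y. G ((\<lambda>j\<in>I. c * y j)(i := c * x)) \<partial>(\<Pi>\<^sub>M i\<in>I. lborel) \<partial>lborel)"
    using insert.hyps \<open>c > 0\<close> by (simp add: ennreal_mult' mult_ac)
  also have "(\<integral>\<^sup>+x. \<integral>\<^sup>+y. G ((\<lambda>j\<in>I. c * y j)(i := c * x)) \<partial>(\<Pi>\<^sub>M i\<in>I. lborel) \<partial>lborel)
      = (\<integral>\<^sup>+x. \<integral>\<^sup>+y. G (\<lambda>j\<in>insert i I. c * (y(i := x)) j) \<partial>(\<Pi>\<^sub>M i\<in>I. lborel) \<partial>lborel)"
    using insert.hyps
    by (intro nn_integral_cong arg_cong[where f = G]) (auto simp: fun_eq_iff)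
  also have "\<dots> = (\<integral>\<^sup>+y. G (\<lambda>j\<in>insert i I. c * y j) \<partial>(\<Pi>\<^sub>M i\<in>insert i I. lborel))"
    by (rule product_nn_integral_insert_rev[symmetric])
       (use insert measurable_compose[OF resc insert.prems] in auto)
  finally show ?case .
qed

lemma nn_integral_mid_measure_scale:
  fixes F :: "real ^ 'n::{finite,linorder} \<Rightarrow> ennreal"
  assumes n: "CARD('n) \<ge> 2" and c: "c > 0" and [measurable]: "F \<in> borel_measurable borel"
  shows "(\<integral>\<^sup>+y. F (mid_embed y) \<partial>mid_measure)
    = ennreal (c ^ (CARD('n) - 2)) * (\<integral>\<^sup>+y. F (c *\<^sub>R mid_embed y) \<partial>mid_measure)"
proof -
  have "(\<integral>\<^sup>+y. F (mid_embed y) \<partial>mid_measure) = ennreal (c ^ card (mid_ix :: 'n set)) *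
      (\<integral>\<^sup>+y. F (mid_embed (\<lambda>i\<in>mid_ix. c * y i)) \<partial>mid_measure)"
    unfolding mid_measure_def
    by (rule nn_integral_PiM_lborel_scale[OF _ c])
       (use measurable_compose[OF measurable_mid_embed assms(3), unfolded mid_measure_def] in auto)
  moreover have "mid_embed (\<lambda>i\<in>mid_ix. c * y i) = c *\<^sub>R mid_embed y" for y :: "'n \<Rightarrow> real"
    by (auto simp: mid_embed_def vec_eq_iff)
  ultimately show ?thesis by (simp only: card_mid_ix[OF n])
qed

section \<open>The substitution by the cotangent\<close>

lemma cot_compare_arctan:
  assumes "0 < \<alpha>" "\<alpha> < pi"
  shows "cot \<alpha> < u \<longleftrightarrow> pi / 2 - arctan u < \<alpha>" and "l < cot \<alpha> \<longleftrightarrow> \<alpha> < pi / 2 - arctan l"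
proof -
  have eq: "arctan (cot \<alpha>) = pi / 2 - \<alpha>"
    using assms arctan_tan[of "pi / 2 - \<alpha>"] by (simp add: tan_cot')
  show "cot \<alpha> < u \<longleftrightarrow> pi / 2 - arctan u < \<alpha>" 
    by (subst arctan_less_iff[symmetric], subst eq) auto
  show "l < cot \<alpha> \<longleftrightarrow> \<alpha> < pi / 2 - arctan l" 
    by (subst arctan_less_iff[symmetric], subst eq) auto
qed

lemma measurable_cot [measurable]: "(cot :: real \<Rightarrow> real) \<in> borel_measurable borel"
  unfolding cot_def[abs_def] by measurable

text \<open>
The cotangent maps \<open>(0, \<pi>)\<close> decreasingly onto the real line, with derivative \<open>-1 / (sin \<alpha>)\<^sup>2\<close>.
Put as an identity of measures, the substitution applies to every nonnegative Borel function, with no question of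
integrability; on intervals it is the fundamental theorem of calculus.
\<close>

lemma lborel_eq_distr_cot:
  "(lborel :: real measure) =
     distr (density lborel (\<lambda>\<alpha>. ennreal (inverse ((sin \<alpha>)\<^sup>2)) * indicator {0<..<pi} \<alpha>)) borel cot"
proof (rule lborel_eqI)
  fix l u :: real
  assume "\<And>b. b \<in> Basis \<Longrightarrow> l \<bullet> b \<le> u \<bullet> b"
  then have "l \<le> u" by simp
  define A where "A x = pi / 2 - arctan x" for x
  have A: "0 < A x" "A x < pi" "cot (A x) = x" for x
    using arctan_bounded[of x] by (auto simp: A_def tan_cot' [symmetric] tan_arctan)
  have "A u \<le> A l"
    using \<open>l \<le> u\<close> by (simp add: A_def arctan_le_iff)
  have deriv: "DERIV (\<lambda>x. - cot x) x :> inverse ((sin x)\<^sup>2)" if "A u \<le> x" "x \<le> A l" for x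
  proof -
    have "0 < sin x"
      using that A(1)[of u] A(2)[of l] by (intro sin_gt_zero) auto
    then show ?thesis
      using DERIV_minus[OF DERIV_cot[of x]] by simp
  qed
  have "emeasure (distr (density lborel (\<lambda>\<alpha>. ennreal (inverse ((sin \<alpha>)\<^sup>2)) * indicator {0<..<pi} \<alpha>))
          borel cot) (box l u)
      = (\<integral>\<^sup>+\<alpha>. ennreal (inverse ((sin \<alpha>)\<^sup>2)) * indicator {0<..<pi} \<alpha> * indicator (cot -` {l<..<u}) \<alpha> \<partial>lborel)"
    using measurable_sets[OF measurable_cot, of "{l<..<u}"]
    by (subst emeasure_distr) (simp_all add: emeasure_density box_real)
  also have "\<dots> = (\<integral>\<^sup>+\<alpha>. ennreal (inverse ((sin \<alpha>)\<^sup>2)) * indicator {A u..A l} \<alpha> \<partial>lborel)"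
  proof (rule nn_integral_cong_AE)
    show "AE \<alpha> in lborel. ennreal (inverse ((sin \<alpha>)\<^sup>2)) * indicator {0<..<pi} \<alpha> * indicator (cot -` {l<..<u}) \<alpha>
        = ennreal (inverse ((sin \<alpha>)\<^sup>2)) * indicator {A u..A l} \<alpha>"
      using AE_lborel_singleton[of "A u"] AE_lborel_singleton[of "A l"]
    proof eventually_elim
      case (elim \<alpha>)
      then show ?case
        using cot_compare_arctan(1)[of \<alpha> u, folded A_def] cot_compare_arctan(2)[of \<alpha> l, folded A_def]
          A(1)[of u] A(2)[of l]
        by (cases "0 < \<alpha> \<and> \<alpha> < pi") (auto simp: indicator_def)
    qed
  qed
  also have "\<dots> = ennreal ((- cot (A l)) - (- cot (A u)))"
    by (rule nn_integral_FTC_Icc[OF _ deriv]) (use \<open>A u \<le> A l\<close> in auto)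
  also have "\<dots> = ennreal (\<Prod>b\<in>Basis. (u - l) \<bullet> b)"
    by (simp add: A)
  finally show "emeasure (distr (density lborel (\<lambda>\<alpha>. ennreal (inverse ((sin \<alpha>)\<^sup>2)) * indicator {0<..<pi} \<alpha>))
          borel cot) (box l u) = ennreal (\<Prod>b\<in>Basis. (u - l) \<bullet> b)" .
qed simp

lemma nn_integral_cot_substitution:
  fixes g :: "real \<Rightarrow> ennreal"
  assumes [measurable]: "g \<in> borel_measurable borel"
  shows "(\<integral>\<^sup>+t. g t \<partial>lborel) =
    (\<integral>\<^sup>+\<alpha>. ennreal (inverse ((sin \<alpha>)\<^sup>2)) * g (cot \<alpha>) * indicator {0<..<pi} \<alpha> \<partial>lborel)"
  by (subst lborel_eq_distr_cot)
     (auto simp: nn_integral_distr nn_integral_density mult_ac intro!: nn_integral_cong)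

section \<open>Integrals of homogeneous functions\<close>

lemma nn_integral_powr_atLeast:
  fixes s h0 :: real
  assumes "s > 0" "h0 > 0"
  shows "(\<integral>\<^sup>+h. ennreal (h powr (- 1 - s)) * indicator {h0..} h \<partial>lborel) = ennreal (h0 powr - s / s)"
proof -
  have "(\<integral>\<^sup>+h. ennreal (h powr (- 1 - s)) * indicator {h0..} h \<partial>lborel)
      = ennreal (0 - (- (h0 powr - s / s)))"
  proof (rule nn_integral_FTC_atLeast)
    show "DERIV (\<lambda>x. - (x powr - s / s)) x :> x powr (- 1 - s)" if "h0 \<le> x" for x
      using that assms by (auto intro!: derivative_eq_intros simp: powr_diff field_simps powr_minus)
    have "((\<lambda>x. x powr - s) \<longlongrightarrow> 0) at_top"
      using assms by (intro tendsto_neg_powr filterlim_ident) auto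
    then show "((\<lambda>x. - (x powr - s / s)) \<longlongrightarrow> 0) at_top"
      using tendsto_divide[OF _ tendsto_const[of s], of "\<lambda>x. x powr - s" 0] tendsto_minus assms by fastforce
  qed auto
  then show ?thesis by simp
qed

lemma e_dir_mid_embed_nth:
  assumes "CARD('n::{finite,linorder}) \<ge> 2"
  shows "(e_dir \<alpha> + mid_embed y :: real ^ 'n::{finite,linorder}) $ first_ix = cos \<alpha>"
    and "(e_dir \<alpha> + mid_embed y :: real ^ 'n::{finite,linorder}) $ last_ix = sin \<alpha>"
  using first_ix_neq_last_ix[OF assms] by (auto simp: e_dir_def mid_embed_def axis_def)

lemma measurable_nn_integral_slice:
  fixes F :: "real ^ 'n::{finite,linorder} \<Rightarrow> ennreal" and p :: "real \<Rightarrow> real ^ 'n::{finite,linorder}"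
  assumes [measurable]: "F \<in> borel_measurable borel" "p \<in> borel_measurable borel"
  shows "(\<lambda>t. \<integral>\<^sup>+y. F (p t + mid_embed y) \<partial>mid_measure) \<in> borel_measurable borel"
proof -
  interpret sigma_finite_measure "mid_measure :: ('n \<Rightarrow> real) measure"
    by (rule sigma_finite_mid_measure)
  show ?thesis by measurable
qed

text \<open>
At height \<open>h\<close> the substitutions \<open>t \<mapsto> h t\<close>, \<open>y \<mapsto> h y\<close> and homogeneity reduce the slice to the
slice at height \<open>1\<close>, up to a power of \<open>h\<close>. At height \<open>1\<close>, \<open>t = cot \<alpha>\<close> and
\<open>y \<mapsto> y / sin \<alpha>\<close> bring the point \<open>(t, y, 1)\<close> to \<open>(cos \<alpha>, y, sin \<alpha>) / sin \<alpha>\<close>. The powers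
of \<open>sin \<alpha>\<close> combine as \<open>-2\<close> from the derivative of the cotangent, \<open>-(n - 2)\<close> from \<open>y\<close> and
\<open>n + s\<close> from homogeneity, which leaves \<open>s\<close>.
\<close>

lemma nn_integral_homogeneous_half_space:
  fixes F :: "real ^ 'n::{finite,linorder} \<Rightarrow> ennreal" and s h0 :: real
  assumes n: "CARD('n) \<ge> 2" and s: "s > 0" and h0: "h0 > 0"
    and F [measurable]: "F \<in> borel_measurable borel"
    and hom: "\<And>c z. c > 0 \<Longrightarrow> F (c *\<^sub>R z) = ennreal (c powr - (real CARD('n) + s)) * F z"
  shows "(\<integral>\<^sup>+z. F z * indicator {z. h0 \<le> z $ last_ix} z \<partial>lborel) =
    ennreal (h0 powr - s / s) *
    (\<integral>\<^sup>+\<alpha>. ennreal (sin \<alpha> powr s) * (\<integral>\<^sup>+y. F (e_dir \<alpha> + mid_embed y) \<partial>mid_measure)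
       * indicator {0<..<pi} \<alpha> \<partial>lborel)"
proof -
  let ?e1 = "axis first_ix 1 :: real ^ 'n::{finite,linorder}" and ?en = "axis last_ix 1 :: real ^ 'n::{finite,linorder}"
  note neq = first_ix_neq_last_ix[OF n]
  define N where "N = CARD('n)"
  have N: "N \<ge> 2" using n by (simp add: N_def)
  define g where "g = (\<lambda>t. \<integral>\<^sup>+y. F (t *\<^sub>R ?e1 + ?en + mid_embed y) \<partial>mid_measure)"
  have g [measurable]: "g \<in> borel_measurable borel"
    unfolding g_def by (rule measurable_nn_integral_slice[where p = "\<lambda>t. t *\<^sub>R ?e1 + ?en"]) auto
  have scale: "(\<integral>\<^sup>+y. F (c *\<^sub>R x + mid_embed y) \<partial>mid_measure) =
      ennreal (c powr (- 2 - s)) * (\<integral>\<^sup>+y. F (x + mid_embed y) \<partial>mid_measure)"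
    if c: "c > 0" for c x
  proof -
    have "(\<integral>\<^sup>+y. F (c *\<^sub>R x + mid_embed y) \<partial>mid_measure) =
        ennreal (c ^ (N - 2)) * (\<integral>\<^sup>+y. F (c *\<^sub>R x + c *\<^sub>R mid_embed y) \<partial>mid_measure)"
      unfolding N_def by (rule nn_integral_mid_measure_scale[OF n c]) measurable
    also have "(\<integral>\<^sup>+y. F (c *\<^sub>R x + c *\<^sub>R mid_embed y) \<partial>mid_measure) =
        (\<integral>\<^sup>+y. ennreal (c powr - (real N + s)) * F (x + mid_embed y) \<partial>mid_measure)"
      by (simp only: scaleR_add_right[symmetric] hom[OF c] N_def)
    also have "\<dots> = ennreal (c powr - (real N + s)) * (\<integral>\<^sup>+y. F (x + mid_embed y) \<partial>mid_measure)"
      by (rule nn_integral_cmult) measurable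
    also have "ennreal (c ^ (N - 2)) * \<dots> =
        ennreal (c ^ (N - 2) * c powr - (real N + s)) * (\<integral>\<^sup>+y. F (x + mid_embed y) \<partial>mid_measure)"
      using c by (simp add: ennreal_mult' mult_ac)
    also have "c ^ (N - 2) * c powr - (real N + s) = c powr (- 2 - s)"
      using c N by (simp add: powr_realpow[symmetric] powr_add[symmetric] of_nat_diff)
    finally show ?thesis .
  qed
  have slice: "(\<integral>\<^sup>+t. \<integral>\<^sup>+y. F (t *\<^sub>R ?e1 + h *\<^sub>R ?en + mid_embed y) \<partial>mid_measure \<partial>lborel) =
      ennreal (h powr (- 1 - s)) * (\<integral>\<^sup>+t. g t \<partial>lborel)" if h: "h > 0" for h
  proof -
    have "(\<integral>\<^sup>+t. \<integral>\<^sup>+y. F (t *\<^sub>R ?e1 + h *\<^sub>R ?en + mid_embed y) \<partial>mid_measure \<partial>lborel) =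
      ennreal h * (\<integral>\<^sup>+t. \<integral>\<^sup>+y. F ((h * t) *\<^sub>R ?e1 + h *\<^sub>R ?en + mid_embed y) \<partial>mid_measure \<partial>lborel)"
      by (subst nn_integral_real_affine[where c = h and t = 0])
         (use h in \<open>auto intro!: measurable_nn_integral_slice[where p = "\<lambda>t. t *\<^sub>R ?e1 + h *\<^sub>R ?en"]\<close>)
    also have "(\<integral>\<^sup>+t. \<integral>\<^sup>+y. F ((h * t) *\<^sub>R ?e1 + h *\<^sub>R ?en + mid_embed y) \<partial>mid_measure \<partial>lborel)
        = (\<integral>\<^sup>+t. ennreal (h powr (- 2 - s)) * g t \<partial>lborel)"
      unfolding g_def scale[OF h, symmetric] by (simp add: scaleR_add_right)
    also have "\<dots> = ennreal (h powr (- 2 - s)) * (\<integral>\<^sup>+t. g t \<partial>lborel)"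
      by (rule nn_integral_cmult) measurable
    also have "ennreal h * \<dots> = ennreal (h powr 1 * h powr (- 2 - s)) * (\<integral>\<^sup>+t. g t \<partial>lborel)"
      using h by (simp add: ennreal_mult' mult_ac)
    also have "h powr 1 * h powr (- 2 - s) = h powr (- 1 - s)"
      by (simp only: powr_add[symmetric]) simp
    finally show ?thesis .
  qed
  have "(\<integral>\<^sup>+z. F z * indicator {z. h0 \<le> z $ last_ix} z \<partial>lborel) =
     (\<integral>\<^sup>+h. \<integral>\<^sup>+t. \<integral>\<^sup>+y. F (t *\<^sub>R ?e1 + h *\<^sub>R ?en + mid_embed y) * indicator {h0..} h
       \<partial>mid_measure \<partial>lborel \<partial>lborel)"
    using neq by (subst nn_integral_lborel_split[OF n])
       (auto intro!: nn_integral_cong simp: indicator_def mid_embed_def axis_def)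
  also have "\<dots> = (\<integral>\<^sup>+h. ennreal (h powr (- 1 - s)) * indicator {h0..} h * (\<integral>\<^sup>+t. g t \<partial>lborel) \<partial>lborel)"
    using slice h0 by (intro nn_integral_cong) (auto simp: indicator_def)
  also have "\<dots> = ennreal (h0 powr - s / s) * (\<integral>\<^sup>+t. g t \<partial>lborel)"
    by (subst nn_integral_multc) (auto simp: nn_integral_powr_atLeast[OF s h0])
  also have "(\<integral>\<^sup>+t. g t \<partial>lborel) =
      (\<integral>\<^sup>+\<alpha>. ennreal (inverse ((sin \<alpha>)\<^sup>2)) * g (cot \<alpha>) * indicator {0<..<pi} \<alpha> \<partial>lborel)"
    by (rule nn_integral_cot_substitution) fact
  also have "\<dots> = (\<integral>\<^sup>+\<alpha>. ennreal (sin \<alpha> powr s) * (\<integral>\<^sup>+y. F (e_dir \<alpha> + mid_embed y) \<partial>mid_measure)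
       * indicator {0<..<pi} \<alpha> \<partial>lborel)"
  proof (rule nn_integral_cong)
    fix \<alpha> :: real
    show "ennreal (inverse ((sin \<alpha>)\<^sup>2)) * g (cot \<alpha>) * indicator {0<..<pi} \<alpha> =
        ennreal (sin \<alpha> powr s) * (\<integral>\<^sup>+y. F (e_dir \<alpha> + mid_embed y) \<partial>mid_measure) * indicator {0<..<pi} \<alpha>"
    proof (cases "\<alpha> \<in> {0<..<pi}")
      case True
      then have pos: "sin \<alpha> > 0" by (auto intro: sin_gt_zero)
      have "cot \<alpha> *\<^sub>R ?e1 + ?en = inverse (sin \<alpha>) *\<^sub>R e_dir \<alpha>"
        using pos by (simp add: e_dir_def cot_def scaleR_add_right field_simps)
      then have "g (cot \<alpha>) = ennreal (inverse (sin \<alpha>) powr (- 2 - s)) *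
          (\<integral>\<^sup>+y. F (e_dir \<alpha> + mid_embed y) \<partial>mid_measure)"
        unfolding g_def using pos by (simp add: scale)
      moreover have "inverse ((sin \<alpha>)\<^sup>2) * inverse (sin \<alpha>) powr (- 2 - s) = sin \<alpha> powr s"
      proof -
        have "inverse (sin \<alpha>) = sin \<alpha> powr - 1" "inverse ((sin \<alpha>)\<^sup>2) = sin \<alpha> powr - 2"
          using pos by (simp_all add: powr_minus)
        then show ?thesis
          by (simp only: powr_powr powr_add[symmetric]) simp
      qed
      ultimately show ?thesis
        using pos by (simp add: mult.assoc[symmetric] ennreal_mult'[symmetric])
    qed simp
  qed
  finally show ?thesis .
qed

text \<open>
Layer cake: \<open>\<bar>z\<bar>\<^sup>-\<^sup>p = \<integral> p u\<^sup>-\<^sup>p\<^sup>-\<^sup>1 du\<close> over \<open>u \<ge> \<bar>z\<bar>\<close>. After exchanging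
the integrals the inner one is at most the volume of the ball of radius \<open>u\<close>, which is a multiple of the
\<open>n\<close>-th power of \<open>u\<close>.
\<close>

lemma nn_integral_norm_powr_tail_finite:
  fixes s r :: real
  assumes s: "s > 0" and r: "r > 0"
  shows "(\<integral>\<^sup>+z. ennreal (norm z powr - (real DIM('a) + s)) * indicator {z. r \<le> norm z} z
            \<partial>(lborel :: 'a::euclidean_space measure)) < \<infinity>"
proof -
  define p where "p = real DIM('a) + s"
  have p: "p > 0" using s by (simp add: p_def add_nonneg_pos)
  let ?f = "\<lambda>(z::'a) u. ennreal (p * u powr (- 1 - p)) * indicator {u. r \<le> norm z \<and> norm z \<le> u} u"
  have layer: "ennreal (norm z powr - p) * indicator {z. r \<le> norm z} z = (\<integral>\<^sup>+u. ?f z u \<partial>lborel)" for z :: 'a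
  proof (cases "r \<le> norm z")
    case True
    with r have "z \<noteq> 0" by auto
    from True have "(\<integral>\<^sup>+u. ?f z u \<partial>lborel) =
        (\<integral>\<^sup>+u. ennreal p * (ennreal (u powr (- 1 - p)) * indicator {norm z..} u) \<partial>lborel)"
      using p by (intro nn_integral_cong) (auto simp: indicator_def ennreal_mult')
    also have "\<dots> = ennreal p * ennreal (norm z powr - p / p)"
      using \<open>z \<noteq> 0\<close> by (subst nn_integral_cmult) (simp_all add: nn_integral_powr_atLeast[OF p, of "norm z"])
    also have "\<dots> = ennreal (norm z powr - p)"
      using p by (simp add: ennreal_mult'[symmetric])
    finally show ?thesis using True by simp
  qed simp
  define V where "V = unit_ball_vol (real DIM('a))"
  have V: "V \<ge> 0" by (simp add: V_def unit_ball_vol_nonneg)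
  have "(\<integral>\<^sup>+z. ennreal (norm z powr - p) * indicator {z::'a. r \<le> norm z} z \<partial>lborel)
      = (\<integral>\<^sup>+z. \<integral>\<^sup>+u. ?f z u \<partial>lborel \<partial>lborel)"
    by (simp only: layer)
  also have "\<dots> = (\<integral>\<^sup>+u. \<integral>\<^sup>+z. ?f z u \<partial>lborel \<partial>lborel)"
    by (rule lborel_pair.Fubini'[symmetric]) measurable
  also have "\<dots> \<le> (\<integral>\<^sup>+u. ennreal (p * V) * (ennreal (u powr (- 1 - s)) * indicator {r..} u) \<partial>lborel)"
  proof (rule nn_integral_mono)
    fix u :: real
    show "(\<integral>\<^sup>+z. ?f z u \<partial>lborel) \<le> ennreal (p * V) * (ennreal (u powr (- 1 - s)) * indicator {r..} u)"
    proof (cases "r \<le> u")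
      case True
      then have u: "u > 0" using r by simp
      have "(\<integral>\<^sup>+z. ?f z u \<partial>lborel) \<le> (\<integral>\<^sup>+z. ennreal (p * u powr (- 1 - p)) * indicator (cball (0::'a) u) z \<partial>lborel)"
        by (intro nn_integral_mono) (auto simp: indicator_def)
      also have "\<dots> = ennreal (p * u powr (- 1 - p)) * emeasure lborel (cball (0::'a) u)"
        by (simp add: nn_integral_cmult_indicator)
      also have "\<dots> = ennreal (p * u powr (- 1 - p)) * ennreal (V * u ^ DIM('a))"
        using u by (simp add: emeasure_cball V_def)
      also have "\<dots> = ennreal (p * V * (u powr (- 1 - p) * u powr real DIM('a)))"
        using u p V by (subst ennreal_mult[symmetric]) (simp_all add: powr_realpow mult_ac)
      also have "u powr (- 1 - p) * u powr real DIM('a) = u powr (- 1 - s)"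
        by (simp add: powr_add[symmetric] p_def)
      finally show ?thesis
        using True p V by (simp add: ennreal_mult')
    next
      case False
      then have "?f z u = 0" for z by (auto simp: indicator_def)
      then show ?thesis by (simp only: nn_integral_const) simp
    qed
  qed
  also have "\<dots> = ennreal (p * V) * ennreal (r powr - s / s)"
    by (subst nn_integral_cmult) (auto simp: nn_integral_powr_atLeast[OF s r])
  also have "\<dots> < \<infinity>" by (simp add: ennreal_mult_less_top)
  finally show ?thesis by (simp add: p_def)
qed

section \<open>Integrability over the middle coordinates\<close>

lemma norm_e_dir_mid_embed:
  assumes "CARD('n::{finite,linorder}) \<ge> 2"
  shows "norm (e_dir \<alpha> :: real ^ 'n::{finite,linorder}) = 1"
    and "(norm (e_dir \<alpha> + mid_embed y :: real ^ 'n::{finite,linorder}))\<^sup>2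
      = 1 + (norm (mid_embed y :: real ^ 'n::{finite,linorder}))\<^sup>2"
    and "(e_dir \<alpha> + mid_embed y :: real ^ 'n::{finite,linorder}) \<noteq> 0"
proof -
  note neq = first_ix_neq_last_ix[OF assms]
  have ed: "(norm (e_dir \<alpha> :: real ^ 'n::{finite,linorder}))\<^sup>2 = 1"
    using neq by (simp add: e_dir_def norm_add_Pythagorean orthogonal_def inner_axis_axis power_mult_distrib)
  then show "norm (e_dir \<alpha> :: real ^ 'n::{finite,linorder}) = 1"
    using norm_ge_zero[of "e_dir \<alpha> :: real ^ 'n::{finite,linorder}"] by (auto simp: power2_eq_1_iff)
  have "orthogonal (e_dir \<alpha> :: real ^ 'n::{finite,linorder}) (mid_embed y)"
    by (simp add: orthogonal_def e_dir_def inner_add_left inner_axis' mid_embed_def)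
  then show sq: "(norm (e_dir \<alpha> + mid_embed y :: real ^ 'n::{finite,linorder}))\<^sup>2
      = 1 + (norm (mid_embed y :: real ^ 'n::{finite,linorder}))\<^sup>2"
    by (simp add: norm_add_Pythagorean ed)
  show "(e_dir \<alpha> + mid_embed y :: real ^ 'n::{finite,linorder}) \<noteq> 0"
  proof
    assume "(e_dir \<alpha> + mid_embed y :: real ^ 'n::{finite,linorder}) = 0"
    with sq have "1 + (norm (mid_embed y :: real ^ 'n::{finite,linorder}))\<^sup>2 = 0" by simp
    then show False
      using zero_le_power2[of "norm (mid_embed y :: real ^ 'n::{finite,linorder})"] by linarith
  qed
qed

lemma norm_e_dir_mid_embed_powr:
  assumes "CARD('n::{finite,linorder}) \<ge> 2"
  shows "norm (e_dir \<alpha> + mid_embed y :: real ^ 'n::{finite,linorder}) powr p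
      = (1 + (norm (mid_embed y :: real ^ 'n::{finite,linorder}))\<^sup>2) powr (p / 2)"
  unfolding norm_e_dir_mid_embed(2)[OF assms, of \<alpha> y, symmetric]
  using norm_e_dir_mid_embed(3)[OF assms, of \<alpha> y] by (simp add: powr_powr flip: powr_numeral)

lemma emeasure_mid_measure_space_pos:
  "emeasure mid_measure (space (mid_measure :: ('n::{finite,linorder} \<Rightarrow> real) measure)) \<noteq> 0"
proof -
  interpret product_sigma_finite "\<lambda>_::'n. lborel :: real measure" by standard
  show ?thesis
    by (simp add: mid_measure_def space_PiM emeasure_PiM)
qed

lemma sin_powr_integral_pos:
  assumes "s > 0"
  shows "(\<integral>\<^sup>+\<alpha>. ennreal (sin \<alpha> powr s) * indicator {0<..<pi} \<alpha> \<partial>lborel) \<noteq> 0"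
proof
  assume "(\<integral>\<^sup>+\<alpha>. ennreal (sin \<alpha> powr s) * indicator {0<..<pi} \<alpha> \<partial>lborel) = 0"
  then have "AE \<alpha> in lborel. ennreal (sin \<alpha> powr s) * indicator {0<..<pi} \<alpha> = 0"
    by (subst (asm) nn_integral_0_iff_AE) auto
  then have "AE \<alpha> in lborel. \<alpha> \<notin> {0<..<pi}"
    by eventually_elim (auto simp: indicator_def dest: sin_gt_zero split: if_splits)
  then have "emeasure lborel {0<..<pi} = 0"
    by (subst (asm) AE_iff_measurable[where N = "{0<..<pi}"]) auto
  then show False by simp
qed

text \<open>
The integral, call it \<open>M\<close>, does not depend on \<open>\<alpha>\<close>. Hence the integral of \<open>\<bar>z\<bar>\<^sup>-\<^sup>n\<^sup>-\<^sup>s\<close> over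
\<open>{z. z\<^sub>n \<ge> 1}\<close>, which is finite, equals \<open>M\<close> times a positive number by the formula for homogeneous
functions. This avoids any direct estimate on the product measure of the middle coordinates.
\<close>

lemma mid_weight_finite:
  fixes \<alpha> s :: real
  assumes n: "CARD('n::{finite,linorder}) \<ge> 2" and s: "s > 0"
  shows "(\<integral>\<^sup>+y. ennreal (norm (e_dir \<alpha> + mid_embed y :: real ^ 'n::{finite,linorder}) powr - (real CARD('n) + s))
    \<partial>mid_measure) < \<infinity>"
proof -
  let ?p = "real CARD('n) + s"
  define F :: "real ^ 'n::{finite,linorder} \<Rightarrow> ennreal" where "F z = ennreal (norm z powr - ?p)" for z
  define M where "M = (\<integral>\<^sup>+y. F (e_dir \<alpha> + mid_embed y) \<partial>mid_measure)"
  have [measurable]: "F \<in> borel_measurable borel"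
    unfolding F_def by measurable
  have M: "(\<integral>\<^sup>+y. F (e_dir \<beta> + mid_embed y) \<partial>mid_measure) = M" for \<beta>
    unfolding M_def F_def norm_e_dir_mid_embed_powr[OF n] ..
  have "(\<integral>\<^sup>+z. F z * indicator {z. 1 \<le> z $ last_ix} z \<partial>lborel) =
    ennreal (1 powr - s / s) *
    (\<integral>\<^sup>+\<alpha>. ennreal (sin \<alpha> powr s) * (\<integral>\<^sup>+y. F (e_dir \<alpha> + mid_embed y) \<partial>mid_measure)
       * indicator {0<..<pi} \<alpha> \<partial>lborel)"
    by (rule nn_integral_homogeneous_half_space[OF n s])
       (auto simp: F_def powr_mult ennreal_mult')
  also have "\<dots> = ennreal (1 / s) * (M * (\<integral>\<^sup>+\<alpha>. ennreal (sin \<alpha> powr s) * indicator {0<..<pi} \<alpha> \<partial>lborel))"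
    unfolding M by (subst nn_integral_cmult[symmetric]) (auto simp: mult_ac)
  finally have eq: "(\<integral>\<^sup>+z. F z * indicator {z. 1 \<le> z $ last_ix} z \<partial>lborel) = \<dots>" .
  have "(\<integral>\<^sup>+z. F z * indicator {z. 1 \<le> z $ last_ix} z \<partial>lborel)
      \<le> (\<integral>\<^sup>+z. F z * indicator {z. 1 \<le> norm z} z \<partial>lborel)"
  proof (rule nn_integral_mono)
    fix z :: "real ^ 'n::{finite,linorder}"
    show "F z * indicator {z. 1 \<le> z $ last_ix} z \<le> F z * indicator {z. 1 \<le> norm z} z"
      using component_le_norm_cart[of z last_ix] by (auto simp: indicator_def)
  qed
  also have "\<dots> < \<infinity>"
    using nn_integral_norm_powr_tail_finite[OF s, of 1, where 'a = "real ^ 'n::{finite,linorder}"]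
    by (simp add: F_def)
  finally have "M \<noteq> \<infinity>"
    unfolding eq using sin_powr_integral_pos[OF s] s by (auto simp: ennreal_mult_eq_top_iff ennreal_top_mult)
  then show ?thesis
    by (simp add: M_def F_def less_top)
qed

section \<open>The kernel and its angular density\<close>

locale anisotropic_kernel =
  fixes a :: "real ^ 'n::{finite,linorder} \<Rightarrow> real" and s :: real
  assumes dim: "CARD('n) \<ge> 2" and s_pos: "s > 0"
    and cont: "continuous_on (sphere 0 1) a"
    and bounds: "\<exists>c C. 0 < c \<and> 0 < C \<and> (\<forall>\<omega>\<in>sphere 0 1. c \<le> a \<omega> \<and> a \<omega> \<le> C)"
    and symmetric: "\<forall>\<omega>\<in>sphere 0 1. a \<omega> = a (- \<omega>)"
begin

abbreviation K :: "real ^ 'n::{finite,linorder} \<Rightarrow> real" where "K \<equiv> aniso_kernel s a"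

lemma measurable_K [measurable]: "K \<in> borel_measurable borel"
proof -
  have "(\<lambda>z. a (sgn z)) \<in> borel_measurable borel"
    by (rule borel_measurable_continuous_countable_exceptions[where X = "{0}"])
       (auto intro!: continuous_on_compose2[OF cont continuous_on_sgn[OF continuous_on_id]] simp: norm_sgn split: if_splits)
  then show ?thesis unfolding aniso_kernel_def by measurable
qed

lemma K_eq_mult_powr: "K z = a (sgn z) * norm z powr - (real CARD('n) + s)"
  by (simp only: aniso_kernel_def powr_minus divide_inverse)

lemma K_scale: "c > 0 \<Longrightarrow> K (c *\<^sub>R z) = c powr - (real CARD('n) + s) * K z"
  by (simp add: K_eq_mult_powr sgn_scaleR powr_mult mult_ac)

lemma K_uminus: "K (- z) = K z"
  using symmetric[rule_format, of "sgn z"]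
  by (cases "z = 0") (simp_all add: aniso_kernel_def sgn_minus norm_sgn)

lemma K_pos: "z \<noteq> 0 \<Longrightarrow> K z > 0"
proof -
  assume "z \<noteq> 0"
  moreover from bounds obtain c where "c > 0" "\<And>\<omega>. norm \<omega> = 1 \<Longrightarrow> c \<le> a \<omega>" by auto
  ultimately show "K z > 0"
    by (metis K_eq_mult_powr less_le_trans mult_pos_pos norm_sgn powr_gt_zero norm_eq_zero)
qed

lemma K_nonneg: "K z \<ge> 0"
  using K_pos[of z] by (cases "z = 0") (auto simp: aniso_kernel_def)

lemma K_le:
  obtains C where "C > 0" "\<And>z. K z \<le> C * norm z powr - (real CARD('n) + s)"
proof -
  from bounds obtain C where C: "C > 0" "\<And>\<omega>. norm \<omega> = 1 \<Longrightarrow> a \<omega> \<le> C" by auto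
  have "K z \<le> C * norm z powr - (real CARD('n) + s)" for z
    using C(2)[of "sgn z"]
    by (cases "z = 0") (auto simp: K_eq_mult_powr norm_sgn intro!: mult_right_mono)
  with C(1) show ?thesis by (rule that)
qed

lemma K_integrable_off_ball:
  assumes "r > 0"
  shows "set_integrable lborel {z. r \<le> norm z} K"
  unfolding set_integrable_def
proof (rule integrableI_nonneg)
  obtain C where C: "C > 0" "\<And>z. K z \<le> C * norm z powr - (real CARD('n) + s)"
    using K_le by blast
  have "(\<integral>\<^sup>+z. ennreal (indicator {z. r \<le> norm z} z *\<^sub>R K z) \<partial>lborel)
      \<le> (\<integral>\<^sup>+z. ennreal C * (ennreal (norm z powr - (real CARD('n) + s)) * indicator {z. r \<le> norm z} z)
        \<partial>(lborel :: (real ^ 'n::{finite,linorder}) measure))"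
    using C by (intro nn_integral_mono) (auto simp: indicator_def ennreal_mult'[symmetric] intro!: ennreal_leI)
  also have "\<dots> = ennreal C * (\<integral>\<^sup>+z. (ennreal (norm z powr - (real CARD('n) + s)) * indicator {z. r \<le> norm z} z)
      \<partial>(lborel :: (real ^ 'n::{finite,linorder}) measure))"
    by (rule nn_integral_cmult) measurable
  also have "\<dots> < \<infinity>"
    using nn_integral_norm_powr_tail_finite[OF s_pos assms, where 'a = "real ^ 'n::{finite,linorder}"]
    by (simp add: ennreal_mult_less_top)
  finally show "(\<integral>\<^sup>+z. ennreal (indicator {z. r \<le> norm z} z *\<^sub>R K z) \<partial>lborel) < \<infinity>" .
qed (auto simp: K_nonneg)

text \<open>
The vectors \<open>e_dir \<alpha>\<close> and \<open>mid_embed y\<close> are orthogonal, so the weight in \<open>a_star\<close> is the power of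
the norm in \<open>K\<close>. For \<open>n = 2\<close> the product over no coordinates is a point mass and \<open>mid_embed\<close> is zero, so the integral is
the value of the kernel at \<open>e(\<alpha>)\<close>; this agrees with the separate clause of \<open>a_star\<close> for the plane.
\<close>

lemma nn_integral_K_slice:
  "(\<integral>\<^sup>+y. ennreal (K (e_dir \<alpha> + mid_embed y)) \<partial>mid_measure) = ennreal (phi s a \<alpha>)"
proof -
  let ?w = "\<lambda>y. e_dir \<alpha> + mid_embed y :: real ^ 'n::{finite,linorder}"
  obtain C where C: "C > 0" "\<And>z. K z \<le> C * norm z powr - (real CARD('n) + s)"
    using K_le by blast
  have "(\<integral>\<^sup>+y. ennreal (K (?w y)) \<partial>mid_measure)
      \<le> (\<integral>\<^sup>+y. ennreal C * ennreal (norm (?w y) powr - (real CARD('n) + s)) \<partial>mid_measure)"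
    using C by (intro nn_integral_mono) (auto simp: ennreal_mult'[symmetric] intro!: ennreal_leI)
  also have "\<dots> = ennreal C * (\<integral>\<^sup>+y. ennreal (norm (?w y) powr - (real CARD('n) + s)) \<partial>mid_measure)"
    by (rule nn_integral_cmult) measurable
  also have "\<dots> < \<infinity>"
    using mid_weight_finite[OF dim s_pos, of \<alpha>] by (simp add: ennreal_mult_less_top)
  finally have "integrable mid_measure (\<lambda>y. K (?w y))"
    by (intro integrableI_nonneg) (auto simp: K_nonneg)
  then have nn: "(\<integral>\<^sup>+y. ennreal (K (?w y)) \<partial>mid_measure) = ennreal (LINT y|mid_measure. K (?w y))"
    by (rule nn_integral_eq_integral) (auto simp: K_nonneg)
  have v: "fst (cos \<alpha>, sin \<alpha>) *\<^sub>R axis first_ix 1 + snd (cos \<alpha>, sin \<alpha>) *\<^sub>R axis last_ix 1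
      = (e_dir \<alpha> :: real ^ 'n::{finite,linorder})" by (simp add: e_dir_def)
  show ?thesis
  proof (cases "CARD('n) = 2")
    case True
    then have emp: "mid_ix = ({} :: 'n set)"
      using card_mid_ix[OF dim] by simp
    then have [simp]: "mid_embed y = (0 :: real ^ 'n::{finite,linorder})" for y
      by (auto simp: mid_embed_def vec_eq_iff)
    interpret product_sigma_finite "\<lambda>_::'n. lborel :: real measure" by standard
    have "(\<integral>\<^sup>+y. ennreal (K (?w y)) \<partial>mid_measure) = ennreal (K (e_dir \<alpha>))"
      unfolding mid_measure_def emp by (subst nn_integral_empty) auto
    also have "K (e_dir \<alpha>) = phi s a \<alpha>"
      using True norm_e_dir_mid_embed(1)[OF dim, of \<alpha>] unfolding phi_def a_star_def v
      by (simp add: aniso_kernel_def Let_def sgn_div_norm)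
    finally show ?thesis .
  next
    case False
    have "phi s a \<alpha> = (LINT y|mid_measure. K (?w y))"
      unfolding phi_def a_star_def v aniso_kernel_def norm_e_dir_mid_embed_powr[OF dim]
      using False by (simp add: Let_def norm_Pair)
    with nn show ?thesis by simp
  qed
qed

lemma phi_pos: "phi s a \<alpha> > 0"
proof (rule ccontr)
  let ?w = "\<lambda>y. e_dir \<alpha> + mid_embed y :: real ^ 'n::{finite,linorder}"
  assume "\<not> phi s a \<alpha> > 0"
  then have "(\<integral>\<^sup>+y. ennreal (K (?w y)) \<partial>mid_measure) = 0"
    by (simp add: nn_integral_K_slice ennreal_neg not_less)
  then have "AE y in mid_measure. ennreal (K (?w y)) = 0"
    by (subst (asm) nn_integral_0_iff_AE) auto
  moreover have "ennreal (K (?w y)) \<noteq> 0" for y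
    using K_pos[OF norm_e_dir_mid_embed(3)[OF dim, of \<alpha> y]] by (simp add: ennreal_eq_0_iff)
  ultimately have "AE y in (mid_measure :: ('n \<Rightarrow> real) measure). False" by simp
  then have "emeasure mid_measure (space (mid_measure :: ('n \<Rightarrow> real) measure)) = 0"
    by (subst (asm) AE_iff_measurable[where N = "space mid_measure"]) auto
  with emeasure_mid_measure_space_pos show False by blast
qed

lemma measurable_phi [measurable]: "phi s a \<in> borel_measurable borel"
proof -
  have "phi s a = (\<lambda>\<alpha>. enn2real (\<integral>\<^sup>+y. ennreal (K (e_dir \<alpha> + mid_embed y)) \<partial>mid_measure))"
    using phi_pos by (simp add: nn_integral_K_slice fun_eq_iff less_imp_le)
  also have "\<dots> \<in> borel_measurable borel"
    by (intro borel_measurable_enn2real measurable_nn_integral_slice)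
       (auto simp: e_dir_def intro!: borel_measurable_add borel_measurable_scaleR)
  finally show ?thesis .
qed

text \<open>
By homogeneity this is the density in \<open>\<alpha>\<close> of the integral of \<open>K\<close> over a half space, up to a factor that
depends only on the height of the half space.
\<close>

definition angular_density :: "real \<Rightarrow> real" where "angular_density \<alpha> = phi s a \<alpha> * sin \<alpha> powr s"

lemma measurable_angular_density [measurable]: "angular_density \<in> borel_measurable borel"
  unfolding angular_density_def by measurable

lemma angular_density_nonneg: "angular_density \<alpha> \<ge> 0"
  using phi_pos[of \<alpha>] by (simp add: angular_density_def)

lemma angular_density_pos: "0 < \<alpha> \<Longrightarrow> \<alpha> < pi \<Longrightarrow> angular_density \<alpha> > 0"
  using phi_pos[of \<alpha>] sin_gt_zero[of \<alpha>] by (simp add: angular_density_def)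

text \<open>
The indicator of a cone is homogeneous of degree zero, so \<open>K\<close> times the indicator of \<open>W\<close> is again a
function to which the formula for homogeneous functions applies.
\<close>

lemma nn_integral_K_cone:
  assumes h0: "h0 > 0" and [measurable]: "W \<in> sets borel"
    and cone: "\<And>c z. c > 0 \<Longrightarrow> c *\<^sub>R z \<in> W \<longleftrightarrow> z \<in> W"
    and W: "\<And>\<alpha> y. \<alpha> \<in> {0<..<pi} \<Longrightarrow> e_dir \<alpha> + mid_embed y \<in> W \<longleftrightarrow> \<alpha> \<in> T"
  shows "(\<integral>\<^sup>+z. ennreal (K z) * indicator ({z. h0 \<le> z $ last_ix} \<inter> W) z \<partial>lborel)
    = ennreal (h0 powr - s / s) * (\<integral>\<^sup>+\<alpha>. ennreal (angular_density \<alpha>) * indicator ({0<..<pi} \<inter> T) \<alpha> \<partial>lborel)"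
proof -
  have "(\<integral>\<^sup>+z. ennreal (K z) * indicator ({z. h0 \<le> z $ last_ix} \<inter> W) z \<partial>lborel)
      = (\<integral>\<^sup>+z. (ennreal (K z) * indicator W z) * indicator {z. h0 \<le> z $ last_ix} z \<partial>lborel)"
    by (intro nn_integral_cong) (auto simp: indicator_def)
  also have "\<dots> = ennreal (h0 powr - s / s) *
    (\<integral>\<^sup>+\<alpha>. ennreal (sin \<alpha> powr s) *
        (\<integral>\<^sup>+y. ennreal (K (e_dir \<alpha> + mid_embed y)) * indicator W (e_dir \<alpha> + mid_embed y) \<partial>mid_measure)
       * indicator {0<..<pi} \<alpha> \<partial>lborel)"
    by (rule nn_integral_homogeneous_half_space[OF dim s_pos h0])
       (auto simp: K_scale cone ennreal_mult' indicator_def)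
  also have "(\<integral>\<^sup>+\<alpha>. ennreal (sin \<alpha> powr s) *
        (\<integral>\<^sup>+y. ennreal (K (e_dir \<alpha> + mid_embed y)) * indicator W (e_dir \<alpha> + mid_embed y) \<partial>mid_measure)
       * indicator {0<..<pi} \<alpha> \<partial>lborel)
     = (\<integral>\<^sup>+\<alpha>. ennreal (angular_density \<alpha>) * indicator ({0<..<pi} \<inter> T) \<alpha> \<partial>lborel)"
    using phi_pos
    by (intro nn_integral_cong)
       (auto simp: W indicator_def angular_density_def nn_integral_K_slice ennreal_mult' less_imp_le mult.commute)
  finally show ?thesis .
qed

lemma half_space_subset_norm:
  "{z. h0 \<le> z $ last_ix} \<subseteq> {z :: real ^ 'n::{finite,linorder}. h0 \<le> norm z}"
  by (auto intro: order_trans[OF _ order_trans[OF abs_ge_self component_le_norm_cart]])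

text \<open>
Read off from the same formula: the integral of \<open>K\<close> over \<open>{z. z\<^sub>n \<ge> 1}\<close> is finite and is a positive
multiple of the integral of the density.
\<close>

lemma angular_density_integrable: "set_integrable lborel {0..pi} angular_density"
proof -
  have "(\<integral>\<^sup>+z. ennreal (K z) * indicator ({z. 1 \<le> z $ last_ix} \<inter> UNIV) z \<partial>lborel)
      = ennreal (1 powr - s / s) * (\<integral>\<^sup>+\<alpha>. ennreal (angular_density \<alpha>) * indicator ({0<..<pi} \<inter> UNIV) \<alpha> \<partial>lborel)"
    by (rule nn_integral_K_cone) auto
  moreover have "(\<integral>\<^sup>+z. ennreal (K z) * indicator ({z. 1 \<le> z $ last_ix} \<inter> UNIV) z \<partial>lborel) < \<infinity>"
  proof -
    have "set_integrable lborel {z. 1 \<le> z $ last_ix} K"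
      by (rule set_integrable_subset[OF K_integrable_off_ball[of 1]]) (use half_space_subset_norm[of 1] in auto)
    then show ?thesis
      unfolding set_integrable_def using K_nonneg
      by (subst (asm) integrable_iff_bounded)
         (auto simp: ennreal_mult' ennreal_indicator mult.commute intro!: nn_integral_cong)
  qed
  ultimately have "(\<integral>\<^sup>+\<alpha>. ennreal (angular_density \<alpha>) * indicator {0<..<pi} \<alpha> \<partial>lborel) < \<infinity>"
    using s_pos by (auto simp: ennreal_mult_less_top)
  moreover have "(\<integral>\<^sup>+\<alpha>. ennreal (angular_density \<alpha>) * indicator {0<..<pi} \<alpha> \<partial>lborel)
     = (\<integral>\<^sup>+\<alpha>. ennreal (indicator {0..pi} \<alpha> *\<^sub>R angular_density \<alpha>) \<partial>lborel)"
    by (intro nn_integral_cong) (auto simp: indicator_def angular_density_def less_le)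
  ultimately show ?thesis
    unfolding set_integrable_def by (intro integrableI_nonneg) (auto simp: angular_density_nonneg)
qed

lemma integral_K_cone:
  assumes h0: "h0 > 0" and W_meas [measurable]: "W \<in> sets borel" and [measurable]: "T \<in> sets borel"
    and cone: "\<And>c z. c > 0 \<Longrightarrow> c *\<^sub>R z \<in> W \<longleftrightarrow> z \<in> W"
    and W: "\<And>\<alpha> y. \<alpha> \<in> {0<..<pi} \<Longrightarrow> e_dir \<alpha> + mid_embed y \<in> W \<longleftrightarrow> \<alpha> \<in> T"
  shows "(LINT z : {z. h0 \<le> z $ last_ix} \<inter> W | lborel. K z)
    = h0 powr - s / s * (LINT \<alpha> : {0<..<pi} \<inter> T | lborel. angular_density \<alpha>)"
proof -
  have "(LINT z : {z. h0 \<le> z $ last_ix} \<inter> W | lborel. K z)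
      = enn2real (\<integral>\<^sup>+z. ennreal (K z) * indicator ({z. h0 \<le> z $ last_ix} \<inter> W) z \<partial>lborel)"
    unfolding set_lebesgue_integral_def using K_nonneg
    by (subst integral_eq_nn_integral)
       (auto simp: ennreal_mult' ennreal_indicator mult.commute intro!: arg_cong[where f = enn2real] nn_integral_cong)
  also have "\<dots> = h0 powr - s / s *
      enn2real (\<integral>\<^sup>+\<alpha>. ennreal (angular_density \<alpha>) * indicator ({0<..<pi} \<inter> T) \<alpha> \<partial>lborel)"
    using s_pos by (subst nn_integral_K_cone[OF h0 W_meas cone W]) (auto simp: enn2real_mult)
  also have "enn2real (\<integral>\<^sup>+\<alpha>. ennreal (angular_density \<alpha>) * indicator ({0<..<pi} \<inter> T) \<alpha> \<partial>lborel)
      = (LINT \<alpha> : {0<..<pi} \<inter> T | lborel. angular_density \<alpha>)"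
    unfolding set_lebesgue_integral_def using angular_density_nonneg
    by (subst integral_eq_nn_integral)
       (auto simp: ennreal_mult' ennreal_indicator mult.commute intro!: arg_cong[where f = enn2real] nn_integral_cong)
  finally show ?thesis .
qed

end

section \<open>The sectors as intersections of half spaces\<close>

lemma polar_upper_half_plane:
  fixes x y :: real
  assumes "y > 0"
  obtains \<beta> \<rho> where "\<beta> \<in> {0<..<pi}" "\<rho> > 0" "x = \<rho> * cos \<beta>" "y = \<rho> * sin \<beta>"
proof -
  define \<beta> where "\<beta> = pi / 2 - arctan (x / y)"
  have \<beta>: "\<beta> \<in> {0<..<pi}"
    using arctan_bounded[of "x / y"] by (auto simp: \<beta>_def)
  then have pos: "sin \<beta> > 0" by (auto intro: sin_gt_zero)
  have "cot \<beta> = x / y"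
    by (simp add: \<beta>_def tan_cot'[symmetric] tan_arctan)
  then have "x = y / sin \<beta> * cos \<beta>"
    using assms pos by (simp add: cot_def field_simps)
  with \<beta> pos assms show ?thesis
    by (intro that[of \<beta> "y / sin \<beta>"]) auto
qed

lemma sin_diff_sign:
  assumes "\<alpha> \<in> {0<..<pi}" "\<theta> \<in> {0<..<pi}"
  shows "0 < sin (\<alpha> - \<theta>) \<longleftrightarrow> \<theta> < \<alpha>" and "sin (\<alpha> - \<theta>) < 0 \<longleftrightarrow> \<alpha> < \<theta>"
proof -
  have "0 < sin (\<alpha> - \<theta>)" if "\<theta> < \<alpha>"
    using assms that by (intro sin_gt_zero) auto
  moreover have "0 < sin (\<theta> - \<alpha>)" if "\<alpha> < \<theta>"
    using assms that by (intro sin_gt_zero) auto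
  moreover have "sin (\<theta> - \<alpha>) = - sin (\<alpha> - \<theta>)"
    using sin_minus[of "\<alpha> - \<theta>"] by simp
  ultimately show "0 < sin (\<alpha> - \<theta>) \<longleftrightarrow> \<theta> < \<alpha>" and "sin (\<alpha> - \<theta>) < 0 \<longleftrightarrow> \<alpha> < \<theta>"
    by (cases \<alpha> \<theta> rule: linorder_cases; force)+
qed

text \<open>
Positive exactly to the left of the oriented line from \<open>0\<close> to \<open>e(\<theta>)\<close>, seen in the plane of the first
and last coordinates.
\<close>

definition side :: "real \<Rightarrow> real ^ 'n::{finite,linorder} \<Rightarrow> real"
  where "side \<theta> z = cos \<theta> * z $ last_ix - sin \<theta> * z $ first_ix"

lemma measurable_side [measurable]: "side \<theta> \<in> borel_measurable borel"
  unfolding side_def[abs_def] by measurable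

lemma side_linear:
  "side \<theta> (x - y) = side \<theta> x - side \<theta> y" "side \<theta> (c *\<^sub>R x) = c * side \<theta> x" "side \<theta> (- x) = - side \<theta> x"
  by (simp_all add: side_def algebra_simps)

lemma side_e_dir:
  assumes "CARD('n::{finite,linorder}) \<ge> 2"
  shows "side \<theta> (e_dir \<alpha> + mid_embed y :: real ^ 'n::{finite,linorder}) = sin (\<alpha> - \<theta>)"
  unfolding side_def e_dir_mid_embed_nth[OF assms] by (simp add: sin_diff mult.commute)

lemma mid_embed_zero: "mid_embed (\<lambda>_. 0) = 0"
  by (simp add: mid_embed_def vec_eq_iff)

text \<open>
In polar coordinates of the first and last coordinate, \<open>side \<theta> x = \<rho> sin (\<beta> - \<theta>)\<close>. Both angles lie in
\<open>(0, \<pi>)\<close>, so the sine has the sign of \<open>\<beta> - \<theta>\<close>.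
\<close>

lemma J_sector_half_space:
  assumes "\<theta> \<in> {0<..<pi}"
  shows "J_sector \<theta> pi = {x. 0 < x $ last_ix \<and> 0 < side \<theta> x}"
    and "J_sector 0 \<theta> = {x. 0 < x $ last_ix \<and> side \<theta> x < 0}"
proof -
  have side: "side \<theta> x = \<rho> * sin (\<beta> - \<theta>)"
    if "x $ first_ix = \<rho> * cos \<beta>" "x $ last_ix = \<rho> * sin \<beta>" for x :: "real ^ 'n::{finite,linorder}" and \<rho> \<beta>
    using that by (simp add: side_def sin_diff algebra_simps)
  have sub: "0 < x $ last_ix \<and> 0 < sin (\<beta> - \<theta>) * side \<theta> x"
    if "\<beta> \<in> {0<..<pi}" "\<beta> \<noteq> \<theta>" "\<rho> > 0" "x $ first_ix = \<rho> * cos \<beta>" "x $ last_ix = \<rho> * sin \<beta>"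
    for x :: "real ^ 'n::{finite,linorder}" and \<rho> \<beta>
    using that sin_gt_zero[of \<beta>] sin_diff_sign[OF that(1) assms]
    by (auto simp: side[OF that(4,5)] zero_less_mult_iff mult_less_0_iff)
  have sup: "\<exists>\<beta>\<in>{0<..<pi}. \<exists>\<rho>>0. (x $ first_ix, x $ last_ix) = (\<rho> * cos \<beta>, \<rho> * sin \<beta>) \<and>
      (0 < side \<theta> x \<longleftrightarrow> \<theta> < \<beta>) \<and> (side \<theta> x < 0 \<longleftrightarrow> \<beta> < \<theta>)"
    if y: "0 < x $ last_ix" for x :: "real ^ 'n::{finite,linorder}"
  proof -
    obtain \<beta> \<rho> where *: "\<beta> \<in> {0<..<pi}" "\<rho> > 0" "x $ first_ix = \<rho> * cos \<beta>" "x $ last_ix = \<rho> * sin \<beta>"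
      by (rule polar_upper_half_plane[OF y])
    show ?thesis
      using * sin_diff_sign[OF *(1) assms]
      by (intro bexI[of _ \<beta>] exI[of _ \<rho>]) (auto simp: side zero_less_mult_iff mult_less_0_iff)
  qed
  have J: "x \<in> J_sector \<theta>1 \<theta>2 \<longleftrightarrow> (\<exists>\<beta>\<in>{\<theta>1<..<\<theta>2}. \<exists>\<rho>>0. x $ first_ix = \<rho> * cos \<beta> \<and> x $ last_ix = \<rho> * sin \<beta>)"
    for x :: "real ^ 'n::{finite,linorder}" and \<theta>1 \<theta>2
    by (simp add: J_sector_def)
  show "J_sector \<theta> pi = {x :: real ^ 'n::{finite,linorder}. 0 < x $ last_ix \<and> 0 < side \<theta> x}"
  proof (intro set_eqI iffI)
    fix x :: "real ^ 'n::{finite,linorder}"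
    assume "x \<in> J_sector \<theta> pi"
    then obtain \<beta> \<rho> where *: "\<beta> \<in> {\<theta><..<pi}" "\<rho> > 0" "x $ first_ix = \<rho> * cos \<beta>" "x $ last_ix = \<rho> * sin \<beta>"
      unfolding J by blast
    then show "x \<in> {x. 0 < x $ last_ix \<and> 0 < side \<theta> x}"
      using sub[of \<beta> \<rho> x] sin_diff_sign[of \<beta> \<theta>] assms by (auto simp: zero_less_mult_iff)
  next
    fix x :: "real ^ 'n::{finite,linorder}"
    assume "x \<in> {x. 0 < x $ last_ix \<and> 0 < side \<theta> x}"
    then show "x \<in> J_sector \<theta> pi"
      using sup[of x] unfolding J by auto
  qed
  show "J_sector 0 \<theta> = {x :: real ^ 'n::{finite,linorder}. 0 < x $ last_ix \<and> side \<theta> x < 0}"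
  proof (intro set_eqI iffI)
    fix x :: "real ^ 'n::{finite,linorder}"
    assume "x \<in> J_sector 0 \<theta>"
    then obtain \<beta> \<rho> where *: "\<beta> \<in> {0<..<\<theta>}" "\<rho> > 0" "x $ first_ix = \<rho> * cos \<beta>" "x $ last_ix = \<rho> * sin \<beta>"
      unfolding J by blast
    then show "x \<in> {x. 0 < x $ last_ix \<and> side \<theta> x < 0}"
      using sub[of \<beta> \<rho> x] sin_diff_sign[of \<beta> \<theta>] assms by (auto simp: zero_less_mult_iff)
  next
    fix x :: "real ^ 'n::{finite,linorder}"
    assume "x \<in> {x. 0 < x $ last_ix \<and> side \<theta> x < 0}"
    then show "x \<in> J_sector 0 \<theta>"
      using sup[of x] unfolding J by auto
  qed
qed

section \<open>The principal value\<close>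

lemma set_integral_reflect:
  fixes f :: "'a::euclidean_space \<Rightarrow> real"
  assumes [measurable]: "f \<in> borel_measurable borel" "S \<in> sets borel"
  shows "(LINT x : S | lborel. f (e - x)) = (LINT z : {z. e - z \<in> S} | lborel. f z)"
proof -
  have lb: "(lborel :: 'a measure) = distr lborel borel (\<lambda>x. e - x)"
    using lborel_affine[of "-1" e] by (simp add: density_1 one_ennreal_def[symmetric])
  have "(LINT z : {z. e - z \<in> S} | lborel. f z) = (LINT z | distr lborel borel (\<lambda>x. e - x). indicator S (e - z) * f z)"
    unfolding set_lebesgue_integral_def lb[symmetric]
    by (intro Bochner_Integration.integral_cong) (auto simp: indicator_def)
  also have "\<dots> = (LINT x | lborel. indicator S x * f (e - x))"
    by (subst integral_distr) auto
  finally show ?thesis by (simp add: set_lebesgue_integral_def)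
qed

lemma set_integral_open_interval_eq_closed:
  fixes f :: "real \<Rightarrow> real"
  assumes [measurable]: "f \<in> borel_measurable borel"
  shows "(LINT x : {a<..<b} | lborel. f x) = (LINT x : {a..b} | lborel. f x)"
proof (rule set_integral_cong_set)
  show "AE x in lborel. x \<in> {a..b} \<longleftrightarrow> x \<in> {a<..<b}"
    using AE_lborel_singleton[of a] AE_lborel_singleton[of b] by eventually_elim auto
qed (auto simp: set_borel_measurable_def)

context anisotropic_kernel
begin

lemma K_integrable_subset:
  assumes "r > 0" "S \<in> sets borel" "S \<subseteq> {z. r \<le> norm z}"
  shows "set_integrable lborel S K"
  by (rule set_integrable_subset[OF K_integrable_off_ball[OF assms(1)]]) (use assms in auto)

text \<open>
Both truncated sectors become subsets of \<open>N\<close>, the half space \<open>side \<theta> z < 0\<close> without a ball about the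
origin: the left one after \<open>x \<mapsto> e(\<theta>) - x\<close>, the right one after the further reflection
\<open>z \<mapsto> - z\<close>, which preserves \<open>K\<close>. The integral over \<open>N\<close> cancels and only the complements
remain. They lie in \<open>\<bar>z\<^sub>n\<bar> \<ge> sin \<theta>\<close>, hence outside the ball if \<open>\<rho> \<le> sin \<theta>\<close>.
\<close>

lemma truncated_difference:
  assumes \<theta>: "\<theta> \<in> {0<..<pi}" and \<rho>: "0 < \<rho>" "\<rho> \<le> sin \<theta>"
  shows "(LINT x : J_sector \<theta> pi - ball (e_dir \<theta>) \<rho> | lborel. K (e_dir \<theta> - x))
          - (LINT x : J_sector 0 \<theta> - ball (e_dir \<theta>) \<rho> | lborel. K (e_dir \<theta> - x))
    = (LINT z : {z. sin \<theta> \<le> z $ last_ix} \<inter> {z. 0 < side \<theta> z} | lborel. K z)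
      - (LINT z : {z. sin \<theta> \<le> z $ last_ix} \<inter> {z. side \<theta> z < 0} | lborel. K z)"
proof -
  let ?e = "e_dir \<theta> :: real ^ 'n::{finite,linorder}" and ?h = "sin \<theta>"
  have e: "?e $ last_ix = ?h" "side \<theta> ?e = 0"
    using e_dir_mid_embed_nth(2)[OF dim, of \<theta> "\<lambda>_. 0"] side_e_dir[OF dim, of \<theta> \<theta> "\<lambda>_. 0"]
    by (simp_all add: mid_embed_zero)
  have tail: "r \<le> norm z" if "r \<le> \<bar>z $ last_ix\<bar>" for r and z :: "real ^ 'n::{finite,linorder}"
    using that component_le_norm_cart[of z last_ix] by linarith
  have int: "set_integrable lborel S K" if "S \<in> sets borel" "S \<subseteq> {z. \<rho> \<le> norm z}" for S
    using K_integrable_subset[OF \<rho>(1) that] .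
  define N where "N = {z :: real ^ 'n::{finite,linorder}. side \<theta> z < 0 \<and> \<rho> \<le> norm z}"
  have [measurable]: "N \<in> sets borel" unfolding N_def by measurable
  have "(LINT x : J_sector \<theta> pi - ball ?e \<rho> | lborel. K (?e - x))
      = (LINT z : {z. e_dir \<theta> - z \<in> J_sector \<theta> pi - ball ?e \<rho>} | lborel. K z)"
    by (rule set_integral_reflect) (simp_all add: J_sector_half_space[OF \<theta>])
  also have "{z. ?e - z \<in> J_sector \<theta> pi - ball ?e \<rho>} = N \<inter> {z. z $ last_ix < ?h}"
    by (auto simp: J_sector_half_space[OF \<theta>] N_def e side_linear dist_norm)
  also have "(LINT z : \<dots> | lborel. K z)
      = (LINT z : N | lborel. K z) - (LINT z : {z. ?h \<le> z $ last_ix} \<inter> {z. side \<theta> z < 0} | lborel. K z)"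
  proof -
    have "(LINT z : (N \<inter> {z. z $ last_ix < ?h}) \<union> ({z. ?h \<le> z $ last_ix} \<inter> {z. side \<theta> z < 0}) | lborel. K z)
      = (LINT z : N \<inter> {z. z $ last_ix < ?h} | lborel. K z)
        + (LINT z : {z. ?h \<le> z $ last_ix} \<inter> {z. side \<theta> z < 0} | lborel. K z)"
      using \<rho> by (intro set_integral_Un int) (auto simp: N_def intro: tail)
    moreover have "(N \<inter> {z. z $ last_ix < ?h}) \<union> ({z. ?h \<le> z $ last_ix} \<inter> {z. side \<theta> z < 0}) = N"
      using \<rho> tail[of \<rho>] by (fastforce simp: N_def)
    ultimately show ?thesis by simp
  qed
  finally have left: "(LINT x : J_sector \<theta> pi - ball ?e \<rho> | lborel. K (?e - x)) = \<dots>" .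
  have "(LINT x : J_sector 0 \<theta> - ball ?e \<rho> | lborel. K (?e - x))
      = (LINT z : {z. e_dir \<theta> - z \<in> J_sector 0 \<theta> - ball ?e \<rho>} | lborel. K z)"
    by (rule set_integral_reflect) (simp_all add: J_sector_half_space[OF \<theta>])
  \<comment> \<open>Written as \<open>0 - z\<close>, the reflection in the origin is another case of the substitution rule.\<close>
  also have "{z. ?e - z \<in> J_sector 0 \<theta> - ball ?e \<rho>} = {z. 0 - z \<in> N \<inter> {z. - ?h < z $ last_ix}}"
    by (auto simp: J_sector_half_space[OF \<theta>] N_def e side_linear dist_norm)
  also have "(LINT z : \<dots> | lborel. K z) = (LINT z : N \<inter> {z. - ?h < z $ last_ix} | lborel. K z)"
    by (subst set_integral_reflect[symmetric]) (simp_all add: K_uminus)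
  also have "\<dots> = (LINT z : N | lborel. K z) - (LINT z : {z. z $ last_ix \<le> - ?h} \<inter> {z. side \<theta> z < 0} | lborel. K z)"
  proof -
    have "(LINT z : (N \<inter> {z. - ?h < z $ last_ix}) \<union> ({z. z $ last_ix \<le> - ?h} \<inter> {z. side \<theta> z < 0}) | lborel. K z)
      = (LINT z : N \<inter> {z. - ?h < z $ last_ix} | lborel. K z)
        + (LINT z : {z. z $ last_ix \<le> - ?h} \<inter> {z. side \<theta> z < 0} | lborel. K z)"
      using \<rho> by (intro set_integral_Un int) (auto simp: N_def intro: tail)
    moreover have "(N \<inter> {z. - ?h < z $ last_ix}) \<union> ({z. z $ last_ix \<le> - ?h} \<inter> {z. side \<theta> z < 0}) = N"
      using \<rho> tail[of \<rho>] by (fastforce simp: N_def)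
    ultimately show ?thesis by simp
  qed
  also have "(LINT z : {z. z $ last_ix \<le> - ?h} \<inter> {z. side \<theta> z < 0} | lborel. K z)
      = (LINT z : {z. 0 - z \<in> {z. z $ last_ix \<le> - ?h} \<inter> {z. side \<theta> z < 0}} | lborel. K z)"
    by (subst set_integral_reflect[symmetric]) (simp_all add: K_uminus)
  also have "{z. 0 - z \<in> {z. z $ last_ix \<le> - ?h} \<inter> {z. side \<theta> z < 0}}
      = {z. ?h \<le> z $ last_ix} \<inter> {z. 0 < side \<theta> z}"
    by (auto simp: side_linear)
  finally show ?thesis unfolding left by simp
qed

lemma principal_value:
  assumes \<theta>: "\<theta> \<in> {0<..<pi}"
  shows "((\<lambda>\<rho>. (LINT x : J_sector \<theta> pi - ball (e_dir \<theta>) \<rho> | lborel. K (e_dir \<theta> - x))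
          - (LINT x : J_sector 0 \<theta> - ball (e_dir \<theta>) \<rho> | lborel. K (e_dir \<theta> - x)))
     \<longlongrightarrow> sin \<theta> powr - s / s * ((LINT \<alpha> : {\<theta>..pi} | lborel. angular_density \<alpha>)
          - (LINT \<alpha> : {0..\<theta>} | lborel. angular_density \<alpha>))) (at_right 0)"
proof (rule tendsto_eventually)
  have pos: "sin \<theta> > 0" using \<theta> by (auto intro: sin_gt_zero)
  have "(LINT z : {z. sin \<theta> \<le> z $ last_ix} \<inter> {z. 0 < side \<theta> z} | lborel. K z)
      = sin \<theta> powr - s / s * (LINT \<alpha> : {0<..<pi} \<inter> {\<theta><..} | lborel. angular_density \<alpha>)"
    using sin_diff_sign[OF _ \<theta>]
    by (intro integral_K_cone[OF pos]) (auto simp: side_linear side_e_dir[OF dim] zero_less_mult_iff)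
  moreover have "{0<..<pi} \<inter> {\<theta><..} = {\<theta><..<pi}" using \<theta> by auto
  moreover have "(LINT z : {z. sin \<theta> \<le> z $ last_ix} \<inter> {z. side \<theta> z < 0} | lborel. K z)
      = sin \<theta> powr - s / s * (LINT \<alpha> : {0<..<pi} \<inter> {..<\<theta>} | lborel. angular_density \<alpha>)"
    using sin_diff_sign[OF _ \<theta>]
    by (intro integral_K_cone[OF pos]) (auto simp: side_linear side_e_dir[OF dim] mult_less_0_iff)
  moreover have "{0<..<pi} \<inter> {..<\<theta>} = {0<..<\<theta>}" using \<theta> by auto
  ultimately have "(LINT x : J_sector \<theta> pi - ball (e_dir \<theta>) \<rho> | lborel. K (e_dir \<theta> - x))
          - (LINT x : J_sector 0 \<theta> - ball (e_dir \<theta>) \<rho> | lborel. K (e_dir \<theta> - x))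
      = sin \<theta> powr - s / s * ((LINT \<alpha> : {\<theta>..pi} | lborel. angular_density \<alpha>)
          - (LINT \<alpha> : {0..\<theta>} | lborel. angular_density \<alpha>))" if "0 < \<rho>" "\<rho> \<le> sin \<theta>" for \<rho>
    by (simp add: truncated_difference[OF \<theta> that] set_integral_open_interval_eq_closed right_diff_distrib)
  then show "\<forall>\<^sub>F \<rho> in at_right 0. (LINT x : J_sector \<theta> pi - ball (e_dir \<theta>) \<rho> | lborel. K (e_dir \<theta> - x))
          - (LINT x : J_sector 0 \<theta> - ball (e_dir \<theta>) \<rho> | lborel. K (e_dir \<theta> - x))
      = sin \<theta> powr - s / s * ((LINT \<alpha> : {\<theta>..pi} | lborel. angular_density \<alpha>)
          - (LINT \<alpha> : {0..\<theta>} | lborel. angular_density \<alpha>))"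
    using pos by (auto simp: eventually_at_right_field intro!: exI[of _ "sin \<theta>"])
qed

lemma lower_half_space_integral:
  assumes \<theta>: "\<theta> \<in> {0<..<pi}"
  shows "(LINT x : - upper_halfspace | lborel. K (e_dir \<theta> - x))
     = sin \<theta> powr - s / s * (LINT \<alpha> : {0..pi} | lborel. angular_density \<alpha>)"
proof -
  let ?e = "e_dir \<theta> :: real ^ 'n::{finite,linorder}"
  have pos: "sin \<theta> > 0" using \<theta> by (auto intro: sin_gt_zero)
  have e: "?e $ last_ix = sin \<theta>"
    using e_dir_mid_embed_nth(2)[OF dim, of \<theta> "\<lambda>_. 0"] by (simp add: mid_embed_zero)
  have "(LINT x : - upper_halfspace | lborel. K (?e - x))
      = (LINT z : {z. ?e - z \<in> - upper_halfspace} | lborel. K z)"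
    by (rule set_integral_reflect) (simp_all add: upper_halfspace_def)
  also have "{z. ?e - z \<in> - upper_halfspace} = {z. sin \<theta> \<le> z $ last_ix} \<inter> UNIV"
    by (auto simp: upper_halfspace_def e)
  also have "(LINT z : \<dots> | lborel. K z)
      = sin \<theta> powr - s / s * (LINT \<alpha> : {0<..<pi} \<inter> UNIV | lborel. angular_density \<alpha>)"
    by (rule integral_K_cone[OF pos]) auto
  finally show ?thesis by (simp add: set_integral_open_interval_eq_closed)
qed

end

section \<open>Monotonicity and the contact angle\<close>

lemma set_integral_adjacent_intervals:
  fixes f :: "real \<Rightarrow> real"
  assumes "set_integrable lborel {a..c} f" "a \<le> b" "b \<le> c"
  shows "(LINT t : {a..c} | lborel. f t) = (LINT t : {a..b} | lborel. f t) + (LINT t : {b..c} | lborel. f t)"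
proof -
  have "set_integrable lborel {a..b} f" "set_integrable lborel {b..c} f"
    using assms by (auto intro!: set_integrable_subset[OF assms(1)])
  then show ?thesis
    using Henstock_Kurzweil_Integration.integral_combine[OF assms(2,3) set_borel_integral_eq_integral(1)[OF assms(1)]]
    by (simp add: set_borel_integral_eq_integral(2) assms(1))
qed

lemma set_integral_upper_limit_less:
  fixes f :: "real \<Rightarrow> real"
  assumes f: "set_integrable lborel {0..b} f" and pos: "\<And>x. x \<in> {0<..<b} \<Longrightarrow> f x > 0"
    and xy: "0 \<le> x" "x < y" "y \<le> b"
  shows "(LINT t : {0..x} | lborel. f t) < (LINT t : {0..y} | lborel. f t)"
proof -
  have int: "set_integrable lborel {x..y} f" "set_integrable lborel {0..y} f"
    using xy by (auto intro!: set_integrable_subset[OF f])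
  have nonneg: "AE t in lborel. 0 \<le> indicator {x..y} t *\<^sub>R f t"
    using AE_lborel_singleton[of x] AE_lborel_singleton[of y]
    by eventually_elim (use xy pos in \<open>force simp: indicator_def less_le\<close>)
  have "(LINT t : {x..y} | lborel. f t) \<noteq> 0"
  proof
    assume "(LINT t : {x..y} | lborel. f t) = 0"
    then have "AE t in lborel. indicator {x..y} t *\<^sub>R f t = 0"
      using integral_nonneg_eq_0_iff_AE[OF int(1)[unfolded set_integrable_def] nonneg]
      by (simp add: set_lebesgue_integral_def)
    then have "AE t in lborel. t \<notin> {x<..<y}"
    proof eventually_elim
      case (elim t)
      then show ?case using pos[of t] xy by (auto simp: indicator_def)
    qed
    then have "emeasure lborel {x<..<y} = 0"
      by (subst (asm) AE_iff_measurable[where N = "{x<..<y}"]) auto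
    with xy show False by simp
  qed
  moreover have "(LINT t : {x..y} | lborel. f t) \<ge> 0"
    unfolding set_lebesgue_integral_def using nonneg by (rule integral_nonneg_AE)
  moreover have "(LINT t : {0..y} | lborel. f t) = (LINT t : {0..x} | lborel. f t) + (LINT t : {x..y} | lborel. f t)"
    using xy by (intro set_integral_adjacent_intervals int) auto
  ultimately show ?thesis by linarith
qed

lemma continuous_on_set_integral_upper_limit:
  fixes f :: "real \<Rightarrow> real"
  assumes "set_integrable lborel {0..b} f"
  shows "continuous_on {0..b} (\<lambda>x. LINT t : {0..x} | lborel. f t)"
proof -
  have "continuous_on {0..b} (\<lambda>x. integral {0..x} f)"
    by (rule indefinite_integral_continuous_1) (rule set_borel_integral_eq_integral[OF assms])
  then show ?thesis
  proof (rule continuous_on_eq)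
    show "integral {0..x} f = (LINT t : {0..x} | lborel. f t)" if "x \<in> {0..b}" for x
      using that
      by (intro set_borel_integral_eq_integral(2)[symmetric] set_integrable_subset[OF assms]) auto
  qed
qed

context anisotropic_kernel
begin

definition angular_mass :: "real \<Rightarrow> real"
  where "angular_mass \<theta> = (LINT \<alpha> : {0..\<theta>} | lborel. angular_density \<alpha>)"

lemma angular_mass_strict_mono: "0 \<le> x \<Longrightarrow> x < y \<Longrightarrow> y \<le> pi \<Longrightarrow> angular_mass x < angular_mass y"
  unfolding angular_mass_def
  by (rule set_integral_upper_limit_less[OF angular_density_integrable]) (auto intro: angular_density_pos)

lemma angular_mass_continuous: "continuous_on {0..pi} angular_mass"
  unfolding angular_mass_def by (rule continuous_on_set_integral_upper_limit[OF angular_density_integrable])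

lemma angular_mass_0: "angular_mass 0 = 0"
  using set_integral_open_interval_eq_closed[of angular_density 0 0]
  by (simp add: angular_mass_def set_lebesgue_integral_def)

lemma angular_mass_split:
  assumes "\<theta> \<in> {0<..<pi}"
  shows "(LINT \<alpha> : {\<theta>..pi} | lborel. angular_density \<alpha>) = angular_mass pi - angular_mass \<theta>"
  using assms set_integral_adjacent_intervals[OF angular_density_integrable, of \<theta>]
  by (simp add: angular_mass_def)

end

lemma ex_tendsto_iff:
  fixes l :: "'b::t2_space"
  assumes "(f \<longlongrightarrow> l) F" "F \<noteq> bot"
  shows "(\<exists>x. (f \<longlongrightarrow> x) F \<and> P x) \<longleftrightarrow> P l"
  using assms tendsto_unique[OF assms(2) assms(1)] by blast

lemma contact_angle_condition_iff:
  fixes a1 a2 :: "real ^ 'n::{finite,linorder} \<Rightarrow> real"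
  assumes "anisotropic_kernel a1 s" and "anisotropic_kernel a2 s" and \<theta>: "\<theta> \<in> {0<..<pi}"
  shows "contact_angle_condition s a1 a2 \<sigma> \<theta> \<longleftrightarrow>
    2 * anisotropic_kernel.angular_mass a1 s \<theta> =
      anisotropic_kernel.angular_mass a1 s pi + \<sigma> * anisotropic_kernel.angular_mass a2 s pi"
proof -
  interpret k1: anisotropic_kernel a1 s by fact
  interpret k2: anisotropic_kernel a2 s by fact
  define q where "q = sin \<theta> powr - s / s"
  have q: "q \<noteq> 0"
    using \<theta> k1.s_pos sin_gt_zero[of \<theta>] by (auto simp: q_def)
  note lim = k1.principal_value[OF \<theta>, folded q_def k1.angular_mass_def, unfolded k1.angular_mass_split[OF \<theta>]]
  have "contact_angle_condition s a1 a2 \<sigma> \<theta> \<longleftrightarrow>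
     q * (k1.angular_mass pi - k1.angular_mass \<theta> - k1.angular_mass \<theta>) + \<sigma> * (q * k2.angular_mass pi) = 0"
    unfolding contact_angle_condition_def k2.lower_half_space_integral[OF \<theta>, folded q_def k2.angular_mass_def]
    by (rule ex_tendsto_iff[OF lim]) simp
  also have "\<dots> \<longleftrightarrow> q * (k1.angular_mass pi + \<sigma> * k2.angular_mass pi - 2 * k1.angular_mass \<theta>) = 0"
    by (simp add: algebra_simps)
  finally show ?thesis using q by auto
qed

theorem theorem1p10:
  fixes s1 s2 \<sigma> :: real
    and a1 a2 :: "real ^ 'n::{finite,linorder} \<Rightarrow> real"
  assumes "CARD('n) \<ge> 2"
    and "s1 \<in> {0<..<1}" and "s2 \<in> {0<..<1}"
    and "continuous_on (sphere 0 1) a1" and "continuous_on (sphere 0 1) a2"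
    and "\<exists>c C. 0 < c \<and> 0 < C \<and> (\<forall>\<omega>\<in>sphere 0 1. c \<le> a1 \<omega> \<and> a1 \<omega> \<le> C)"
    and "\<exists>c C. 0 < c \<and> 0 < C \<and> (\<forall>\<omega>\<in>sphere 0 1. c \<le> a2 \<omega> \<and> a2 \<omega> \<le> C)"
    and "\<forall>\<omega>\<in>sphere 0 1. a1 \<omega> = a1 (- \<omega>)" and "\<forall>\<omega>\<in>sphere 0 1. a2 \<omega> = a2 (- \<omega>)"
    and "s1 = s2 \<or> \<sigma> = 0"
  shows "(\<exists>\<^sub>\<le>\<^sub>1 \<theta>. \<theta> \<in> {0<..<pi} \<and> contact_angle_condition s1 a1 a2 \<sigma> \<theta>)
    \<and> (\<bar>\<sigma>\<bar> < (LINT \<alpha> : {0..pi} | lborel. phi s1 a1 \<alpha> * sin \<alpha> powr s1)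
              / (LINT \<alpha> : {0..pi} | lborel. phi s2 a2 \<alpha> * sin \<alpha> powr s1)
        \<longrightarrow> (\<exists>!\<theta>. \<theta> \<in> {0<..<pi} \<and> contact_angle_condition s1 a1 a2 \<sigma> \<theta>))"
proof -
  \<comment> \<open>Both kernels carry the exponent \<open>s1\<close>, so \<open>a2\<close> enters through \<open>phi s1 a2\<close>.\<close>
  have kernels: "anisotropic_kernel a1 s1" "anisotropic_kernel a2 s1"
    using assms by (simp_all only: anisotropic_kernel_def greaterThanLessThan_iff simp_thms)
  interpret k1: anisotropic_kernel a1 s1 by (rule kernels)
  interpret k2: anisotropic_kernel a2 s1 by (rule kernels)
  define t where "t = k1.angular_mass pi + \<sigma> * k2.angular_mass pi"
  have iff: "contact_angle_condition s1 a1 a2 \<sigma> \<theta> \<longleftrightarrow> 2 * k1.angular_mass \<theta> = t"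
    if "\<theta> \<in> {0<..<pi}" for \<theta>
    unfolding t_def by (rule contact_angle_condition_iff[OF kernels that])
  have unique: "\<theta> = \<theta>'"
    if "\<theta> \<in> {0<..<pi}" "\<theta>' \<in> {0<..<pi}" "2 * k1.angular_mass \<theta> = t" "2 * k1.angular_mass \<theta>' = t" for \<theta> \<theta>'
    using that k1.angular_mass_strict_mono[of \<theta> \<theta>'] k1.angular_mass_strict_mono[of \<theta>' \<theta>]
    by (cases \<theta> \<theta>' rule: linorder_cases) auto
  have m1: "k1.angular_mass pi = (LINT \<alpha> : {0..pi} | lborel. phi s1 a1 \<alpha> * sin \<alpha> powr s1)"
    by (simp add: k1.angular_mass_def k1.angular_density_def)
  have m2: "k2.angular_mass pi = (LINT \<alpha> : {0..pi} | lborel. phi s1 a2 \<alpha> * sin \<alpha> powr s1)"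
    by (simp add: k2.angular_mass_def k2.angular_density_def)
  have pos: "0 < k1.angular_mass pi" "0 < k2.angular_mass pi"
    using k1.angular_mass_strict_mono[of 0 pi] k2.angular_mass_strict_mono[of 0 pi]
    by (simp_all add: k1.angular_mass_0 k2.angular_mass_0)
  have exists: "\<exists>\<theta>\<in>{0<..<pi}. 2 * k1.angular_mass \<theta> = t"
    if bound: "\<bar>\<sigma>\<bar> < (LINT \<alpha> : {0..pi} | lborel. phi s1 a1 \<alpha> * sin \<alpha> powr s1)
              / (LINT \<alpha> : {0..pi} | lborel. phi s2 a2 \<alpha> * sin \<alpha> powr s1)"
  proof -
    have "\<bar>\<sigma> * k2.angular_mass pi\<bar> < k1.angular_mass pi"
      using assms(10)
    proof
      assume "s1 = s2"
      then have "\<bar>\<sigma>\<bar> < k1.angular_mass pi / k2.angular_mass pi"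
        using bound unfolding m1 m2 by simp
      then show ?thesis
        using pos by (simp add: pos_less_divide_eq abs_mult)
    qed (use pos in simp)
    then have between: "0 < t / 2" "t / 2 < k1.angular_mass pi"
      by (auto simp: t_def abs_less_iff)
    then obtain \<theta> where \<theta>: "0 \<le> \<theta>" "\<theta> \<le> pi" "k1.angular_mass \<theta> = t / 2"
      using IVT'[OF _ _ _ k1.angular_mass_continuous, of "t / 2"] by (auto simp: k1.angular_mass_0)
    then have "\<theta> \<noteq> 0" "\<theta> \<noteq> pi"
      using between by (auto simp: k1.angular_mass_0)
    with \<theta> show ?thesis by (intro bexI[of _ \<theta>]) auto
  qed
  show ?thesis
  proof (intro conjI impI)
    show "\<exists>\<^sub>\<le>\<^sub>1 \<theta>. \<theta> \<in> {0<..<pi} \<and> contact_angle_condition s1 a1 a2 \<sigma> \<theta>"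
      unfolding Uniq_def using unique iff by blast
    assume "\<bar>\<sigma>\<bar> < (LINT \<alpha> : {0..pi} | lborel. phi s1 a1 \<alpha> * sin \<alpha> powr s1)
              / (LINT \<alpha> : {0..pi} | lborel. phi s2 a2 \<alpha> * sin \<alpha> powr s1)"
    from exists[OF this] show "\<exists>!\<theta>. \<theta> \<in> {0<..<pi} \<and> contact_angle_condition s1 a1 a2 \<sigma> \<theta>"
      using unique iff by blast
  qed
qed

end
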